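(* Fix $c_0\in\mathfrak{h}^*\setminus\{0\}$ and set $c_t=c_0-ta_H$. Suppose $c_t\neq0$ for $t\in[0,T)$. Then the family of maps $\{F_t\colon(\mu_H^{-1}(c_0)\cap L)\times H\to M\}_{t\in[0,T)}$ defined by $F_t(p,h)=\gamma_p(t)h$ is a Lagrangian mean curvature flow.
   Context: $M=\mathbb{C}^d$ with its standard complex structure $I$, K\"ahler form $\omega$, holomorphic volume form $\Omega=dz_1\wedge\dots\wedge dz_d$ and flat metric $g$. $H=S^1=\{\zeta\in\mathbb{C} : |\zeta|=1\}$ with Lie algebra $\mathfrak{h}$; $\xi_0\in\mathfrak{h}$ is such that $\mathrm{Exp}_H t\xi_0=e^{\sqrt{-1}t}$, and $\xi^0\in\mathfrak{h}^*$ satisfies $\langle\xi^0,\xi_0\rangle=1$. Fix $\lambda_1,\dots,\lambda_d\in\mathbb{Z}\setminus\{0\}$; $H$ acts on $M$ by $z\,\mathrm{Exp}_Ht\xi_0=(z_1e^{\sqrt{-1}\lambda_1t},\dots,z_de^{\sqrt{-1}\lambda_dt})$, with moment map $\mu_H(z)=\frac12(\sum_{i=1}^d\lambda_i|z_i|^2)\xi^0$. Put $a_H=(\lambda_1+\dots+\lambda_d)\xi^0$ and $L=\mathbb{R}^d\setminus\{(0,\dots,0)\}\subset M$. For $\xi\in\mathfrak{h}$, $\xi^\#$ is the vector field on $M$ generated by $\xi$. For $x\in L$ let $\tilde\xi(x)\in\mathfrak{h}$ be defined by $g_x(\tilde\xi(x)^\#_x,\eta^\#_x)=\langle a_H,\eta\rangle$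 for all $\eta\in\mathfrak{h}$, and let $\chi_x=I_x\tilde\xi(x)^\#_x\in T_xL$; this is a vector field on $L$. For $p\in\mu_H^{-1}(c_0)\cap L$, $\gamma_p$ is the integral curve of $\chi$ with $\gamma_p(0)=p$; its existence on $[0,T)$ is part of the assertion. A Lagrangian mean curvature flow is a smooth family of Lagrangian immersions $F_t$ such that $\frac{\partial F_t}{\partial t}$ equals the mean curvature vector of $F_t$. *)

theory Defs
  imports "HOL-Analysis.Analysis"
begin

section \<open>Smooth maps and embedded submanifolds\<close>

text \<open>Only meaningful for open \<open>S\<close>, because \<open>frechet_derivative\<close> is taken in the full space.\<close>

primrec Ck_on :: "nat \<Rightarrow> 'a::real_normed_vector set \<Rightarrow> ('a \<Rightarrow> 'b::real_normed_vector) \<Rightarrow> bool" where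
  "Ck_on 0 S f \<longleftrightarrow> continuous_on S f"
| "Ck_on (Suc k) S f \<longleftrightarrow>
     (\<forall>x\<in>S. f differentiable (at x)) \<and> (\<forall>v. Ck_on k S (\<lambda>x. frechet_derivative f (at x) v))"

text \<open>Smoothness on an arbitrary subset of a Euclidean space: locally, the map is the restriction
  of a \<open>C\<^sup>\<infinity>\<close> map defined on an open set of the ambient space.\<close>

definition smooth_map_on :: "'a::euclidean_space set \<Rightarrow> ('a \<Rightarrow> 'b::euclidean_space) \<Rightarrow> bool" where
  "smooth_map_on S f \<longleftrightarrow>
     (\<forall>x\<in>S. \<exists>W g. open W \<and> x \<in> W \<and> (\<forall>k. Ck_on k W g) \<and> (\<forall>y\<in>W \<inter> S. g y = f y))"

text \<open>A diffeomorphism \<open>\<phi>\<close> of an open set \<open>U\<close> of \<open>\<real>\<^sup>m\<close> onto an open subset of \<open>N\<close>,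
  where \<open>m = CARD('m)\<close>.\<close>

definition local_param ::
  "'a::euclidean_space set \<Rightarrow> (real^'m) set \<Rightarrow> (real^'m \<Rightarrow> 'a) \<Rightarrow> bool" where
  "local_param N U \<phi> \<longleftrightarrow>
     open U \<and> openin (top_of_set N) (\<phi> ` U) \<and> smooth_map_on U \<phi> \<and>
     (\<exists>\<psi>. smooth_map_on (\<phi> ` U) \<psi> \<and> (\<forall>u\<in>U. \<psi> (\<phi> u) = u))"

text \<open>The dimension \<open>CARD('m)\<close> of the submanifold is passed as a type.\<close>

definition smooth_submanifold :: "'m::finite itself \<Rightarrow> 'a::euclidean_space set \<Rightarrow> bool" where
  "smooth_submanifold _ N \<longleftrightarrow>
     (\<forall>p\<in>N. \<exists>U (\<phi> :: real^'m \<Rightarrow> 'a). local_param N U \<phi> \<and> p \<in> \<phi> ` U)"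


section \<open>Mean curvature vector of a parametrized immersion\<close>

definition partial :: "'m::finite \<Rightarrow> (real^'m \<Rightarrow> 'b::euclidean_space) \<Rightarrow> real^'m \<Rightarrow> 'b" where
  "partial i f u = frechet_derivative f (at u) (axis i 1)"

definition first_fundamental_form ::
  "(real^'m \<Rightarrow> 'b::euclidean_space) \<Rightarrow> real^'m \<Rightarrow> real^'m^'m" where
  "first_fundamental_form f u = (\<chi> i j. partial i f u \<bullet> partial j f u)"

definition normal_part :: "'b::euclidean_space set \<Rightarrow> 'b \<Rightarrow> 'b" where
  "normal_part V v = (THE w. w \<in> orthogonal_comp V \<and> v - w \<in> V)"

definition second_fundamental_form ::
  "(real^'m \<Rightarrow> 'b::euclidean_space) \<Rightarrow> real^'m \<Rightarrow> 'm \<Rightarrow> 'm \<Rightarrow> 'b" where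
  "second_fundamental_form f u i j =
     normal_part (range (frechet_derivative f (at u))) (partial i (partial j f) u)"

text \<open>The trace of the second fundamental form, not divided by the dimension.\<close>

definition mean_curvature_vector ::
  "(real^'m \<Rightarrow> 'b::euclidean_space) \<Rightarrow> real^'m \<Rightarrow> 'b" where
  "mean_curvature_vector f u =
     (\<Sum>i\<in>UNIV. \<Sum>j\<in>UNIV.
        matrix_inv (first_fundamental_form f u) $ i $ j *\<^sub>R second_fundamental_form f u i j)"


section \<open>Lagrangian mean curvature flow in complex Euclidean space\<close>

text \<open>The flat metric \<open>g\<close> on \<open>complex^'n\<close> is the real inner product.\<close>

definition cplx_structure :: "complex^'n \<Rightarrow> complex^'n" where
  "cplx_structure v = \<i> *s v"

definition kaehler_form :: "complex^'n \<Rightarrow> complex^'n \<Rightarrow> real" where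
  "kaehler_form v w = cplx_structure v \<bullet> w"

text \<open>The half-dimensionality of \<open>N\<close> is built in: \<open>N\<close> and the complex target have the same
  index type \<open>'n\<close>.\<close>

definition lagrangian_immersion ::
  "'a::euclidean_space set \<Rightarrow> ('a \<Rightarrow> complex^'n) \<Rightarrow> bool" where
  "lagrangian_immersion N f \<longleftrightarrow>
     smooth_submanifold TYPE('n) N \<and> smooth_map_on N f \<and>
     (\<forall>U (\<phi> :: real^'n \<Rightarrow> 'a). local_param N U \<phi> \<longrightarrow>
        (\<forall>u\<in>U. let D = frechet_derivative (f \<circ> \<phi>) (at u)
               in inj D \<and> (\<forall>v w. kaehler_form (D v) (D w) = 0)))"

text \<open>The mean curvature vector at a point of \<open>N\<close> does not depend on the local parametrization
  in which it is computed, so the evolution equation is required in all of them. At an endpoint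
  of \<open>J\<close> the time derivative is one-sided.\<close>

definition lagrangian_mcf ::
  "real set \<Rightarrow> 'a::euclidean_space set \<Rightarrow> (real \<Rightarrow> 'a \<Rightarrow> complex^'n) \<Rightarrow> bool" where
  "lagrangian_mcf J N F \<longleftrightarrow>
     smooth_submanifold TYPE('n) N \<and>
     smooth_map_on (J \<times> N) (\<lambda>(t, q). F t q) \<and>
     (\<forall>t\<in>J. lagrangian_immersion N (F t)) \<and>
     (\<forall>t\<in>J. \<forall>U (\<phi> :: real^'n \<Rightarrow> 'a). local_param N U \<phi> \<longrightarrow>
        (\<forall>u\<in>U. ((\<lambda>s. F s (\<phi> u)) has_vector_derivative
                   mean_curvature_vector (F t \<circ> \<phi>) u) (at t within J)))"


section \<open>The circle action\<close>

text \<open>The circle group \<open>H\<close> is \<open>sphere (0::complex) 1\<close>. Its Lie algebra is identified with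
  \<open>real\<close> by \<open>s \<mapsto> s \<xi>\<^sub>0\<close>, so that \<open>cis\<close> is the exponential map; the dual of the Lie algebra is
  identified with \<open>real\<close> by \<open>c \<mapsto> c \<xi>\<^sup>0\<close>, so that the pairing is multiplication.\<close>

definition act :: "('n::finite \<Rightarrow> int) \<Rightarrow> complex^'n \<Rightarrow> complex \<Rightarrow> complex^'n" where
  "act lam z h = (\<chi> i. z $ i * h powi lam i)"

definition moment_map :: "('n::finite \<Rightarrow> int) \<Rightarrow> complex^'n \<Rightarrow> real" where
  "moment_map lam z = (1/2) * (\<Sum>i\<in>UNIV. of_int (lam i) * (cmod (z $ i))\<^sup>2)"

definition a_H :: "('n::finite \<Rightarrow> int) \<Rightarrow> real" where
  "a_H lam = of_int (\<Sum>i\<in>UNIV. lam i)"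

definition generated_vf :: "('n::finite \<Rightarrow> int) \<Rightarrow> real \<Rightarrow> complex^'n \<Rightarrow> complex^'n" where
  "generated_vf lam \<xi> z = vector_derivative (\<lambda>t. act lam z (cis (t * \<xi>))) (at 0)"

definition punctured_real_space :: "(complex^'n) set" where
  "punctured_real_space = {z. \<forall>i. z $ i \<in> \<real>} - {0}"

definition xi_tilde :: "('n::finite \<Rightarrow> int) \<Rightarrow> complex^'n \<Rightarrow> real" where
  "xi_tilde lam x =
     (THE \<xi>. \<forall>\<eta>. generated_vf lam \<xi> x \<bullet> generated_vf lam \<eta> x = a_H lam * \<eta>)"

definition chi_vf :: "('n::finite \<Rightarrow> int) \<Rightarrow> complex^'n \<Rightarrow> complex^'n" where
  "chi_vf lam x = cplx_structure (generated_vf lam (xi_tilde lam x) x)"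

definition integral_curve_on ::
  "real set \<Rightarrow> 'a::real_normed_vector set \<Rightarrow> ('a \<Rightarrow> 'a) \<Rightarrow> (real \<Rightarrow> 'a) \<Rightarrow> bool" where
  "integral_curve_on J L X c \<longleftrightarrow>
     (\<forall>t\<in>J. c t \<in> L \<and> (c has_vector_derivative X (c t)) (at t within J))"

text \<open>The interval \<open>[0,T)\<close>, where \<open>T = \<infinity>\<close> is allowed.\<close>

definition time_interval :: "ereal \<Rightarrow> real set" where
  "time_interval T = {t. 0 \<le> t \<and> ereal t < T}"

end

theory Submission
  imports Defs
begin

text \<open>The flow is explicit, and the geometry at each time reduces to one trace computation.

\<^bold>\<open>The integral curves.\<close> Write \<open>a = \<Sum>\<lambda>\<^sub>j\<close> and \<open>\<Lambda>x = (\<lambda>\<^sub>j x\<^sub>j)\<^sub>j\<close>. On a nonzero real vector \<open>x\<close> the vector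
field \<open>\<chi>\<close> is \<open>-(a / \<bar>\<Lambda>x\<bar>\<^sup>2) \<Lambda>x\<close> (\<open>chi_vf_cvec\<close>), a rescaled generator of the real one-parameter
group \<open>s \<mapsto> (exp (-\<lambda>\<^sub>j s) x\<^sub>j)\<^sub>j\<close>, the noncompact direction of the complexified circle. The moment map
is strictly decreasing along the orbit of every nonzero vector, and the factor in \<open>\<chi>\<close> makes it change at
the constant rate \<open>-a\<close>. So \<open>\<gamma>\<^sub>p(t)\<close> can only be the point of the orbit of \<open>p\<close> at which the moment
map equals \<open>c\<^sub>0 - t a\<close>. That point exists, because \<open>c\<^sub>0 - t a\<close> keeps the sign of \<open>c\<^sub>0\<close> and a moment map
value that is positive (negative) somewhere on the orbit takes all positive (negative) values there
(\<open>height_dilate_attains\<close>). It depends smoothly on \<open>(t, p)\<close>, because the moment map has nonzero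
derivative along the orbit (\<open>Ck_on_level_time\<close>). Existence of \<open>\<gamma>\<^sub>p\<close> on \<open>[0,T)\<close>, its uniqueness
(\<open>integral_curve_unique\<close>) and the smoothness of the family all follow from this description.

\<^bold>\<open>The geometry.\<close> In every parametrization \<open>F\<^sub>t\<close> has components \<open>y\<^sub>j h\<^bsup>\<lambda>\<^sub>j\<^esup>\<close>, where \<open>y\<close> is a real vector
on a level set of the moment map and \<open>h\<close> lies on the unit circle (locale \<open>circle_sweep\<close>). With
\<open>\<theta> = Im (cnj h dh)\<close>, the differential is, up to the unitary rotation by \<open>h\<close>, the map
\<open>v \<mapsto> dy(v) + \<i> \<theta>(v) \<Lambda>y\<close>, and \<open>dy(v)\<close> is orthogonal to \<open>\<Lambda>y\<close> because \<open>y\<close> stays on the level set. This gives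
the Lagrangian condition at once, so the normal space is \<open>I\<close> times the tangent space. One more
differentiation expresses \<open>\<langle>\<partial>\<^sub>i \<partial>\<^sub>k f, I \<partial>\<^sub>m f\<rangle>\<close> through \<open>dy\<close>, \<open>\<theta>\<close> and \<open>\<Lambda>\<close> (\<open>cubic_form\<close>). Its trace over \<open>i, k\<close>
is \<open>a \<theta>\<^sub>m\<close> (\<open>weighted_trace\<close>): the real vectors \<open>dy(e\<^sub>i) + \<theta>\<^sub>i \<Lambda>y\<close> have the Gram matrix of the induced metric,
so that the trace in the induced metric turns into an ordinary trace over \<open>\<real>\<^sup>n\<close>. In other words, the
Lagrangian angle is \<open>a \<theta>\<close> up to a constant. The rotated vector \<open>\<chi>\<close> is normal and has the same products
\<open>a \<theta>\<^sub>m\<close> with the normal vectors \<open>I \<partial>\<^sub>m f\<close>, so it is the mean curvature vector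
(\<open>mean_curvature_vector_f\<close>); by construction of \<open>\<gamma>\<close> it is also the time derivative of \<open>F\<^sub>t\<close>.\<close>

section \<open>Calculus of \<open>C\<^sup>k\<close> maps\<close>

lemma Ck_on_cong:
  assumes "open S" "\<And>x. x \<in> S \<Longrightarrow> f x = g x" "Ck_on k S f"
  shows "Ck_on k S g"
  using assms(2,3)
proof (induction k arbitrary: f g)
  case 0
  then show ?case by (simp cong: continuous_on_cong)
next
  case (Suc k)
  have *: "(g has_derivative frechet_derivative f (at x)) (at x)" if "x \<in> S" for x
    using Suc.prems that assms(1)
    by (auto intro!: has_derivative_transform_within_open[of f _ x UNIV S g] simp: frechet_derivative_works[symmetric])
  have eq: "frechet_derivative f (at x) = frechet_derivative g (at x)" if "x \<in> S" for x
    using *[OF that] by (rule frechet_derivative_at)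
  have "Ck_on k S (\<lambda>x. frechet_derivative g (at x) v)" for v
    using Suc.IH[of "\<lambda>x. frechet_derivative f (at x) v" "\<lambda>x. frechet_derivative g (at x) v"] Suc.prems(2) eq
    by auto
  then show ?case
    using * by (auto simp: differentiable_def)
qed

text \<open>The step of most inductions on the order of differentiability: any formula for the derivative will do, and only
its values in fixed directions have to be one order less smooth.\<close>

lemma Ck_on_SucI:
  assumes "open S" "\<And>x. x \<in> S \<Longrightarrow> (f has_derivative f' x) (at x)"
    and "\<And>v. Ck_on k S (\<lambda>x. f' x v)"
  shows "Ck_on (Suc k) S f"
proof -
  have "f' x = frechet_derivative f (at x)" if "x \<in> S" for x
    using assms(2)[OF that] by (rule frechet_derivative_at)
  then have "Ck_on k S (\<lambda>x. frechet_derivative f (at x) v)" for v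
    using Ck_on_cong[OF assms(1) _ assms(3)[of v]] by auto
  then show ?thesis
    using assms(2) by (auto simp: differentiable_def)
qed

lemma Ck_on_has_derivative:
  assumes "Ck_on (Suc k) S f" "x \<in> S"
  shows "(f has_derivative frechet_derivative f (at x)) (at x)"
  using assms by (simp add: frechet_derivative_works[symmetric])

lemma Ck_on_Suc_imp: "Ck_on (Suc k) S f \<Longrightarrow> Ck_on k S f"
proof (induction k arbitrary: f)
  case 0
  then show ?case
    by (auto intro!: continuous_at_imp_continuous_on differentiable_imp_continuous_within)
next
  case (Suc k)
  then show ?case by (metis Ck_on.simps(2))
qed

lemma Ck_on_imp_continuous_on: "Ck_on k S f \<Longrightarrow> continuous_on S f"
proof (induction k)
  case (Suc k)
  then show ?case using Ck_on_Suc_imp by blast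
qed simp

lemma Ck_on_subset: "Ck_on k S f \<Longrightarrow> R \<subseteq> S \<Longrightarrow> Ck_on k R f"
proof (induction k arbitrary: f)
  case 0
  then show ?case by (auto intro: continuous_on_subset)
qed auto

text \<open>Turns the local extensions in \<open>smooth_map_on\<close> into regularity of
the map itself on open sets.\<close>

lemma Ck_on_local:
  assumes "\<And>x. x \<in> S \<Longrightarrow> \<exists>W. open W \<and> x \<in> W \<and> Ck_on k W f"
  shows "Ck_on k S f"
  using assms
proof (induction k arbitrary: f)
  case 0
  have "continuous (at x) f" if "x \<in> S" for x
    using 0[OF that] continuous_on_eq_continuous_at by auto
  then show ?case
    by (simp add: continuous_at_imp_continuous_on)
next
  case (Suc k)
  have "Ck_on k S (\<lambda>x. frechet_derivative f (at x) v)" for v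
    by (rule Suc.IH) (use Suc.prems in fastforce)
  then show ?case
    using Suc.prems by fastforce
qed

lemma Ck_on_const: "Ck_on k S (\<lambda>x. c)"
  by (induction k arbitrary: c) (auto simp: frechet_derivative_const)

lemma Ck_on_linear_compose:
  assumes "bounded_linear L" "open S" "Ck_on k S f"
  shows "Ck_on k S (\<lambda>x. L (f x))"
  using assms(3)
proof (induction k arbitrary: f)
  case 0
  then show ?case
    by (simp add: assms(1) bounded_linear.continuous_on)
next
  case (Suc k)
  show ?case
  proof (rule Ck_on_SucI[OF assms(2)])
    show "((\<lambda>x. L (f x)) has_derivative (\<lambda>v. L (frechet_derivative f (at x) v))) (at x)" if "x \<in> S" for x
      using Ck_on_has_derivative[OF Suc.prems that] assms(1)
      by (rule bounded_linear.has_derivative[rotated])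
  qed (use Suc in auto)
qed

lemma Ck_on_ident: "Ck_on k S (\<lambda>x. x)"
proof (cases k)
  case (Suc j)
  then show ?thesis by (simp add: Ck_on_const)
qed simp

lemma Ck_on_linear:
  assumes "bounded_linear L" shows "Ck_on k S L"
  using Ck_on_subset[OF Ck_on_linear_compose[OF assms open_UNIV Ck_on_ident]] by auto

lemma Ck_on_add:
  assumes "open S" "Ck_on k S f" "Ck_on k S g"
  shows "Ck_on k S (\<lambda>x. f x + g x)"
  using assms(2,3)
proof (induction k arbitrary: f g)
  case 0
  then show ?case by (simp add: continuous_on_add)
next
  case (Suc k)
  show ?case
  proof (rule Ck_on_SucI[OF assms(1)])
    fix x assume "x \<in> S"
    show "((\<lambda>x. f x + g x) has_derivative
        (\<lambda>v. frechet_derivative f (at x) v + frechet_derivative g (at x) v)) (at x)"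
      using Suc.prems \<open>x \<in> S\<close> by (intro has_derivative_add Ck_on_has_derivative)
  qed (use Suc in auto)
qed

lemma Ck_on_sum:
  assumes "open S" "\<And>i. i \<in> A \<Longrightarrow> Ck_on k S (f i)"
  shows "Ck_on k S (\<lambda>x. \<Sum>i\<in>A. f i x)"
  using assms(2)
  by (induction A rule: infinite_finite_induct) (auto simp: Ck_on_const intro: Ck_on_add[OF assms(1)])

lemma (in bounded_bilinear) Ck_on:
  assumes "open S" "Ck_on k S f" "Ck_on k S g"
  shows "Ck_on k S (\<lambda>x. prod (f x) (g x))"
  using assms(2,3)
proof (induction k arbitrary: f g)
  case 0
  then show ?case by (simp add: continuous_on)
next
  case (Suc k)
  have fg: "Ck_on k S f" "Ck_on k S g"
    by (rule Ck_on_Suc_imp, rule Suc.prems)+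
  show ?case
  proof (rule Ck_on_SucI[OF assms(1)])
    fix x assume "x \<in> S"
    show "((\<lambda>x. prod (f x) (g x)) has_derivative
        (\<lambda>v. prod (f x) (frechet_derivative g (at x) v) + prod (frechet_derivative f (at x) v) (g x))) (at x)"
      using Suc.prems \<open>x \<in> S\<close> by (intro FDERIV Ck_on_has_derivative)
  next
    fix v
    show "Ck_on k S (\<lambda>x. prod (f x) (frechet_derivative g (at x) v) + prod (frechet_derivative f (at x) v) (g x))"
      using Suc fg by (intro Ck_on_add[OF assms(1)]) auto
  qed
qed

lemmas Ck_on_mult = bounded_bilinear.Ck_on[OF bounded_bilinear_mult]
lemmas Ck_on_scaleR = bounded_bilinear.Ck_on[OF bounded_bilinear_scaleR]

lemma Ck_on_power:
  fixes f :: "'a::real_normed_vector \<Rightarrow> 'b::real_normed_algebra_1"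
  assumes "open S" "Ck_on k S f"
  shows "Ck_on k S (\<lambda>x. f x ^ n)"
  by (induction n) (auto simp: Ck_on_const intro: Ck_on_mult assms)

text \<open>The chain rule writes a directional derivative of the composite as a finite sum, over a basis of the intermediate
space, of products of functions to which the induction hypothesis applies. This is why that space is Euclidean.\<close>

lemma Ck_on_compose:
  fixes f :: "'b::euclidean_space \<Rightarrow> 'c::real_normed_vector"
  assumes "open S" "Ck_on k R f" "Ck_on k S g" "\<And>x. x \<in> S \<Longrightarrow> g x \<in> R"
  shows "Ck_on k S (\<lambda>x. f (g x))"
  using assms(2-)
proof (induction k arbitrary: f g)
  case 0
  then show ?case
    using continuous_on_compose2[of R f S g] by (simp add: image_subset_iff)
next
  case (Suc k)
  have g: "Ck_on k S g"
    by (rule Ck_on_Suc_imp, rule Suc.prems)+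
  show ?case
  proof (rule Ck_on_SucI[OF assms(1)])
    fix x assume x: "x \<in> S"
    have gx: "g x \<in> R"
      using Suc.prems(3) x .
    have lin: "linear (frechet_derivative f (at (g x)))"
      by (rule has_derivative_linear[OF Ck_on_has_derivative[OF Suc.prems(1) gx]])
    have deriv: "((\<lambda>x. f (g x)) has_derivative
        (\<lambda>v. frechet_derivative f (at (g x)) (frechet_derivative g (at x) v))) (at x)"
      by (rule has_derivative_compose[OF Ck_on_has_derivative[OF Suc.prems(2) x]
            Ck_on_has_derivative[OF Suc.prems(1) gx]])
    have rep: "frechet_derivative f (at (g x)) w =
        (\<Sum>b\<in>Basis. (w \<bullet> b) *\<^sub>R frechet_derivative f (at (g x)) b)" for w
    proof -
      have "frechet_derivative f (at (g x)) w = frechet_derivative f (at (g x)) (\<Sum>b\<in>Basis. (w \<bullet> b) *\<^sub>R b)"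
        by (simp only: euclidean_representation)
      also have "\<dots> = (\<Sum>b\<in>Basis. (w \<bullet> b) *\<^sub>R frechet_derivative f (at (g x)) b)"
        by (simp only: linear_sum[OF lin] linear_scale[OF lin])
      finally show ?thesis .
    qed
    show "((\<lambda>x. f (g x)) has_derivative (\<lambda>v. \<Sum>b\<in>Basis.
        (frechet_derivative g (at x) v \<bullet> b) *\<^sub>R frechet_derivative f (at (g x)) b)) (at x)"
      unfolding rep[symmetric] by (rule deriv)
  next
    fix v
    show "Ck_on k S (\<lambda>x. \<Sum>b\<in>Basis.
        (frechet_derivative g (at x) v \<bullet> b) *\<^sub>R frechet_derivative f (at (g x)) b)"
    proof (intro Ck_on_sum Ck_on_scaleR assms(1))
      fix b :: 'b
      show "Ck_on k S (\<lambda>x. frechet_derivative g (at x) v \<bullet> b)"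
        by (rule Ck_on_linear_compose[OF bounded_linear_inner_left assms(1)]) (use Suc.prems in simp)
      show "Ck_on k S (\<lambda>x. frechet_derivative f (at (g x)) b)"
        using Suc.prems(1) by (intro Suc.IH[OF _ g Suc.prems(3)]) simp_all
    qed
  qed
qed

lemma Ck_on_Pair:
  assumes "open S" "Ck_on k S f" "Ck_on k S g"
  shows "Ck_on k S (\<lambda>x. (f x, g x))"
proof -
  have 1: "bounded_linear (\<lambda>x. (x, 0))" "bounded_linear (\<lambda>x. (0, x))"
    by (auto intro!: bounded_linear_Pair bounded_linear_ident bounded_linear_zero)
  have "Ck_on k S (\<lambda>x. (f x, 0) + (0, g x))"
    by (intro Ck_on_add assms Ck_on_linear_compose[OF 1(1)] Ck_on_linear_compose[OF 1(2)])
  then show ?thesis by simp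
qed

lemma bounded_linear_axis: "bounded_linear (axis i :: 'b::euclidean_space \<Rightarrow> 'b^'n)"
  by (intro linear_conv_bounded_linear[THEN iffD1] linearI) (auto simp: vec_eq_iff axis_def)

lemma Ck_on_vec_lambda:
  fixes f :: "'n::finite \<Rightarrow> 'a::real_normed_vector \<Rightarrow> 'b::euclidean_space"
  assumes "open S" "\<And>i. Ck_on k S (f i)"
  shows "Ck_on k S (\<lambda>x. \<chi> i. f i x)"
proof -
  have "(\<chi> i. f i x) = (\<Sum>i\<in>UNIV. axis i (f i x))" for x
    by (simp add: vec_eq_iff axis_def if_distrib cong: if_cong)
  then show ?thesis
    using Ck_on_sum[OF assms(1) Ck_on_linear_compose[OF bounded_linear_axis assms(1,2)]] by simp
qed

lemma Ck_on_vec_nth: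
  fixes f :: "'a::real_normed_vector \<Rightarrow> 'b::real_normed_vector^'n"
  assumes "open S" "Ck_on k S f"
  shows "Ck_on k S (\<lambda>x. f x $ i)"
  using Ck_on_linear_compose[OF bounded_linear_vec_nth assms] .

text \<open>The three functions below satisfy differential equations \<open>f' = f\<close>, \<open>f' = -f\<^sup>2\<close> and \<open>f' = 1/(2f)\<close>, which
raise their regularity step by step.\<close>

lemma Ck_on_exp: "Ck_on k S (exp :: real \<Rightarrow> real)"
proof -
  have "Ck_on k UNIV (exp :: real \<Rightarrow> real)"
  proof (induction k)
    case 0
    then show ?case using continuous_on_exp[OF continuous_on_id] by simp
  next
    case (Suc k)
    show ?case
    proof (rule Ck_on_SucI)
      show "(exp has_derivative (\<lambda>v. v * exp x)) (at x)" for x :: real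
        by (auto intro!: derivative_eq_intros)
    qed (auto intro!: Ck_on_mult Ck_on_const Suc)
  qed
  then show ?thesis by (rule Ck_on_subset) auto
qed

lemma Ck_on_inverse: "Ck_on k (- {0}) (inverse :: real \<Rightarrow> real)"
proof (induction k)
  case 0
  then show ?case using continuous_on_inverse[OF continuous_on_id, of "- {0::real}"] by auto
next
  case (Suc k)
  show ?case
  proof (rule Ck_on_SucI)
    show "(inverse has_derivative (\<lambda>v. (- v) * (inverse x * inverse x))) (at x)"
      if "x \<in> - {0}" for x :: real
      using that by (auto intro!: derivative_eq_intros)
    show "Ck_on k (- {0}) (\<lambda>x. (- v) * (inverse x * inverse x))" for v :: real
      by (intro Ck_on_mult Ck_on_const Suc) auto
  qed auto
qed

lemma Ck_on_sqrt: "Ck_on k {0<..} sqrt"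
proof (induction k)
  case 0
  then show ?case using continuous_on_real_sqrt[OF continuous_on_id] by simp
next
  case (Suc k)
  show ?case
  proof (rule Ck_on_SucI)
    show "(sqrt has_derivative (\<lambda>v. v * (inverse (sqrt x) * (1/2)))) (at x)"
      if "x \<in> {0<..}" for x
      using that by (auto intro!: derivative_eq_intros simp: field_simps)
    show "Ck_on k {0<..} (\<lambda>x. v * (inverse (sqrt x) * (1/2)))" for v
    proof (intro Ck_on_mult Ck_on_const)
      show "Ck_on k {0<..} (\<lambda>x. inverse (sqrt x))"
        by (rule Ck_on_compose[OF _ Ck_on_inverse Suc]) auto
    qed auto
  qed simp
qed

lemma smooth_map_on_open_imp_Ck_on:
  assumes "open S" "smooth_map_on S f"
  shows "Ck_on k S f"
proof (rule Ck_on_local)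
  fix x assume "x \<in> S"
  then obtain W g where W: "open W" "x \<in> W" "Ck_on k W g" "\<forall>y\<in>W \<inter> S. g y = f y"
    using assms(2) unfolding smooth_map_on_def by blast
  have "Ck_on k (W \<inter> S) f"
    by (rule Ck_on_cong[of _ g]) (use W assms(1) in \<open>auto intro: Ck_on_subset\<close>)
  then show "\<exists>W. open W \<and> x \<in> W \<and> Ck_on k W f"
    using W assms(1) \<open>x \<in> S\<close> by blast
qed

lemma smooth_map_onI:
  assumes "open W" "S \<subseteq> W" "\<And>k. Ck_on k W g" "\<And>y. y \<in> S \<Longrightarrow> g y = f y"
  shows "smooth_map_on S f"
  using assms unfolding smooth_map_on_def by (metis IntD2 subsetD)

section \<open>Traces over a Gram matrix, and normal parts\<close>

lemma matrix_inv_cancel: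
  fixes A :: "'a::semiring_1^'n^'m"
  assumes "invertible A"
  shows "matrix_inv A ** A = mat 1" "A ** matrix_inv A = mat 1"
  using someI_ex[OF assms[unfolded invertible_def]] unfolding matrix_inv_def by auto

text \<open>If the columns of \<open>A\<close> form a basis, then the inverse of its Gram matrix is the coordinate form of the inner product:
\<open>A (A\<^sup>T A)\<^sup>-\<^sup>1 A\<^sup>T = 1\<close>.\<close>

lemma gram_inverse:
  fixes A :: "real^'n^'n"
  assumes "invertible A"
  shows "(\<Sum>i\<in>UNIV. \<Sum>k\<in>UNIV. matrix_inv (transpose A ** A) $ i $ k *
            ((column i A \<bullet> x) * (column k A \<bullet> z))) = x \<bullet> z"
proof -
  define P where "P = matrix_inv (transpose A ** A)"
  have "invertible (transpose A ** A)"
    by (intro invertible_mult transpose_invertible assms)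
  then have P: "P ** (transpose A ** A) = mat 1"
    unfolding P_def by (rule matrix_inv_cancel)
  define B where "B = matrix_inv A"
  have B: "A ** B = mat 1"
    using assms unfolding B_def by (rule matrix_inv_cancel)
  have "A ** P ** transpose A = A ** (P ** (transpose A ** A)) ** B"
    using B by (simp add: matrix_mul_assoc[symmetric])
  also have "\<dots> = mat 1"
    unfolding P using B by simp
  finally have one: "A ** P ** transpose A = mat 1" .
  have col: "column i A \<bullet> w = (transpose A *v w) $ i" for i w
    by (simp add: column_def inner_vec_def matrix_vector_mult_def transpose_def)
  have "(\<Sum>i\<in>UNIV. \<Sum>k\<in>UNIV. P $ i $ k * ((column i A \<bullet> x) * (column k A \<bullet> z)))
      = (transpose A *v x) \<bullet> (P *v (transpose A *v z))"
    unfolding col inner_vec_def[of "transpose A *v x"] matrix_vector_mult_def[of P]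
    by (simp add: sum_distrib_left mult_ac del: transpose_matrix_vector)
  also have "\<dots> = x \<bullet> ((A ** P ** transpose A) *v z)"
    by (simp add: dot_lmul_matrix matrix_vector_mul_assoc[symmetric] del: transpose_matrix_vector)
       (simp add: dot_lmul_matrix)
  finally show ?thesis
    unfolding P_def[symmetric] one by simp
qed

text \<open>The trace that computes the mean curvature. Here \<open>n\<close> stands for \<open>\<Lambda>y\<close>, and \<open>d i\<close>, \<open>th i\<close> for the derivatives of \<open>y\<close> and of
the angle, so that \<open>g\<close> is the induced metric. The vectors \<open>d i + th i n\<close> form a basis with Gram matrix \<open>g\<close>, hence
traces with respect to \<open>g\<close> are traces over \<open>\<real>\<^sup>n\<close>. The weights restricted to the complement of \<open>n\<close> contribute
\<open>\<Sum>\<lambda>\<^sub>j - Q/\<bar>n\<bar>\<^sup>2\<close>, the cubic term contributes \<open>Q/\<bar>n\<bar>\<^sup>2\<close>, and the two mixed terms vanish because \<open>th\<close> is represented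
by \<open>n\<close> and \<open>d\<close> is orthogonal to it.\<close>

lemma weighted_trace:
  fixes n :: "real^'n" and d :: "'n \<Rightarrow> real^'n" and th lam :: "'n \<Rightarrow> real"
  assumes n: "n \<noteq> 0"
    and orth: "\<And>i. d i \<bullet> n = 0"
    and inj: "inj (\<lambda>v::real^'n. \<Sum>i\<in>UNIV. v $ i *\<^sub>R (d i + th i *\<^sub>R n))"
  defines "B \<equiv> \<lambda>i k. \<Sum>j\<in>UNIV. lam j * d i $ j * d k $ j"
    and "Q \<equiv> \<Sum>j\<in>UNIV. lam j * (n $ j)\<^sup>2"
    and "g \<equiv> \<chi> i k. d i \<bullet> d k + (n \<bullet> n) * th i * th k"
  shows "(\<Sum>i\<in>UNIV. \<Sum>k\<in>UNIV. matrix_inv g $ i $ k *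
           (B i k * th m + B k m * th i + B i m * th k + Q * th i * th k * th m))
         = (\<Sum>j\<in>UNIV. lam j) * th m"
proof -
  define A :: "real^'n^'n" where "A = (\<chi> j i. (d i + th i *\<^sub>R n) $ j)"
  have col: "column i A = d i + th i *\<^sub>R n" for i
    by (simp add: A_def column_def vec_eq_iff)
  have "(*v) A = (\<lambda>v. \<Sum>i\<in>UNIV. v $ i *\<^sub>R (d i + th i *\<^sub>R n))"
    by (rule ext) (simp add: A_def matrix_vector_mult_def vec_eq_iff mult.commute)
  then have "inj ((*v) A)"
    by (rule ssubst) (rule inj)
  then have A: "invertible A"
    unfolding invertible_left_inverse matrix_left_invertible_injective .
  have S: "n \<bullet> n \<noteq> 0"
    using n by simp
  have orth': "n \<bullet> d i = 0" for i
    using orth[of i] by (simp add: inner_commute)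
  have g: "g = transpose A ** A"
    by (simp add: g_def matrix_mult_transpose_dot_column col vec_eq_iff inner_add_left inner_add_right
        orth orth')
  define P where "P = matrix_inv g"
  have P: "(\<Sum>i\<in>UNIV. \<Sum>k\<in>UNIV. P $ i $ k * ((column i A \<bullet> x) * (column k A \<bullet> z))) = x \<bullet> z" for x z
    unfolding P_def g by (rule gram_inverse[OF A])
  \<comment> \<open>The angle and the real part of a column are linear functionals of it, so the three kinds of
    traces below are inner products of the representing vectors.\<close>
  have th: "th i = column i A \<bullet> (n /\<^sub>R (n \<bullet> n))" for i
    using S orth by (simp add: col inner_add_left)
  have d: "d i $ j = column i A \<bullet> (axis j 1 - (n $ j / (n \<bullet> n)) *\<^sub>R n)" for i j
    using S orth by (simp add: col inner_add_left inner_diff_right inner_axis)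
  have T1: "(\<Sum>i\<in>UNIV. \<Sum>k\<in>UNIV. P $ i $ k * (th i * d k $ j)) = 0" for j
    unfolding th d P using S by (simp add: inner_diff_right inner_axis divide_inverse mult.commute)
  have T2: "(\<Sum>i\<in>UNIV. \<Sum>k\<in>UNIV. P $ i $ k * (d i $ j * th k)) = 0" for j
    unfolding th d P using S by (simp add: inner_diff_left inner_axis' divide_inverse mult.commute)
  have T3: "(\<Sum>i\<in>UNIV. \<Sum>k\<in>UNIV. P $ i $ k * (th i * th k)) = 1 / (n \<bullet> n)"
    unfolding th P using S by (simp add: field_simps)
  have T4: "(\<Sum>i\<in>UNIV. \<Sum>k\<in>UNIV. P $ i $ k * (d i $ j * d k $ j)) = 1 - (n $ j)\<^sup>2 / (n \<bullet> n)" for j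
    unfolding d P using S
    by (simp add: inner_diff_left inner_diff_right inner_axis' inner_axis power2_eq_square)
  have expand: "P $ i $ k * (B i k * th m + B k m * th i + B i m * th k + Q * th i * th k * th m) =
     (\<Sum>j\<in>UNIV. th m * lam j * (P $ i $ k * (d i $ j * d k $ j)))
     + (\<Sum>j\<in>UNIV. lam j * d m $ j * (P $ i $ k * (th i * d k $ j)))
     + (\<Sum>j\<in>UNIV. lam j * d m $ j * (P $ i $ k * (d i $ j * th k)))
     + Q * th m * (P $ i $ k * (th i * th k))" for i k
    by (simp add: B_def distrib_left sum_distrib_left sum_distrib_right mult_ac)
  have swap: "(\<Sum>i\<in>UNIV. \<Sum>k\<in>UNIV. \<Sum>j\<in>UNIV. c j * (P $ i $ k * u i k j)) =
      (\<Sum>j\<in>UNIV. c j * (\<Sum>i\<in>UNIV. \<Sum>k\<in>UNIV. P $ i $ k * u i k j))"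
    for c :: "'n \<Rightarrow> real" and u :: "'n \<Rightarrow> 'n \<Rightarrow> 'n \<Rightarrow> real"
  proof -
    have "(\<Sum>i\<in>UNIV. \<Sum>k\<in>UNIV. \<Sum>j\<in>UNIV. c j * (P $ i $ k * u i k j)) =
       (\<Sum>i\<in>UNIV. \<Sum>j\<in>UNIV. \<Sum>k\<in>UNIV. c j * (P $ i $ k * u i k j))"
      by (intro sum.cong refl sum.swap)
    also have "\<dots> = (\<Sum>j\<in>UNIV. \<Sum>i\<in>UNIV. \<Sum>k\<in>UNIV. c j * (P $ i $ k * u i k j))"
      by (rule sum.swap)
    finally show ?thesis
      by (simp add: sum_distrib_left)
  qed
  have "(\<Sum>i\<in>UNIV. \<Sum>k\<in>UNIV. P $ i $ k *
           (B i k * th m + B k m * th i + B i m * th k + Q * th i * th k * th m)) =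
        (\<Sum>j\<in>UNIV. th m * lam j * (1 - (n $ j)\<^sup>2 / (n \<bullet> n))) + Q * th m * (1 / (n \<bullet> n))"
    unfolding expand sum.distrib swap T1 T2 T4 sum_distrib_left[symmetric] T3 by simp
  also have "(\<Sum>j\<in>UNIV. th m * lam j * (1 - (n $ j)\<^sup>2 / (n \<bullet> n))) =
      th m * (\<Sum>j\<in>UNIV. lam j) - th m * Q / (n \<bullet> n)"
    unfolding Q_def sum_distrib_left sum_divide_distrib sum_subtractf[symmetric]
    by (intro sum.cong refl) (simp add: algebra_simps)
  finally show ?thesis
    unfolding P_def by (simp add: algebra_simps)
qed

text \<open>For a subspace the orthogonal decomposition is unique, so the definite description in \<open>normal_part\<close> denotes a vector.\<close>

lemma normal_part:
  fixes V :: "'a::euclidean_space set"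
  assumes "subspace V"
  shows "normal_part V v \<in> orthogonal_comp V" "v - normal_part V v \<in> V"
proof -
  obtain y z where yz: "y \<in> span V" "\<And>w. w \<in> span V \<Longrightarrow> orthogonal z w" "v = y + z"
    using orthogonal_subspace_decomp_exists[of V v] by metis
  have "\<exists>!w. w \<in> orthogonal_comp V \<and> v - w \<in> V"
  proof (intro ex1I conjI)
    show "z \<in> orthogonal_comp V"
      using yz by (auto simp: orthogonal_comp_def orthogonal_commute span_base)
    show "v - z \<in> V"
      using yz assms by (simp add: span_eq_iff[THEN iffD2])
  next
    fix w assume w: "w \<in> orthogonal_comp V \<and> v - w \<in> V"
    have "w - z \<in> V"
      using subspace_diff[OF assms, of y "v - w"] yz w assms by (simp add: span_eq_iff[THEN iffD2])
    moreover have "w - z \<in> orthogonal_comp V"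
      using w yz by (intro subspace_diff subspace_orthogonal_comp)
        (auto simp: orthogonal_comp_def orthogonal_commute span_base)
    ultimately show "w = z"
      by (auto simp: orthogonal_comp_def orthogonal_def)
  qed
  from theI'[OF this] show "normal_part V v \<in> orthogonal_comp V" "v - normal_part V v \<in> V"
    unfolding normal_part_def by auto
qed

lemma has_derivative_nth:
  fixes g :: "'a::real_normed_vector \<Rightarrow> real^'n"
  assumes "(g has_derivative g') F"
  shows "((\<lambda>x. g x $ j) has_derivative (\<lambda>v. g' v $ j)) F"
  using assms by (rule bounded_linear.has_derivative[OF bounded_linear_vec_nth])

lemma has_derivative_vec_lambda:
  fixes f :: "'n::finite \<Rightarrow> 'a::real_normed_vector \<Rightarrow> 'b::euclidean_space"
  assumes "\<And>i. (f i has_derivative f' i) F"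
  shows "((\<lambda>x. \<chi> i. f i x) has_derivative (\<lambda>v. \<chi> i. f' i v)) F"
proof -
  have *: "(\<chi> i. c i) = (\<Sum>i\<in>UNIV. axis i (c i))" for c :: "'n \<Rightarrow> 'b"
    by (simp add: vec_eq_iff axis_def if_distrib cong: if_cong)
  show ?thesis
    unfolding * by (intro has_derivative_sum bounded_linear.has_derivative[OF bounded_linear_axis] assms)
qed

section \<open>The circle action and its derivative\<close>

definition cvec :: "real^'n \<Rightarrow> complex^'n" where
  "cvec x = (\<chi> i. complex_of_real (x $ i))"

lemma linear_act: "linear (\<lambda>v. act lam v h)"
  by (intro linearI) (simp_all add: act_def vec_eq_iff distrib_right)

lemma inner_act_act:
  assumes "cmod h = 1"
  shows "act lam v h \<bullet> act lam w h = v \<bullet> w"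
proof -
  have "(a * k) \<bullet> (b * k) = a \<bullet> b" if "cmod k = 1" for a b k :: complex
  proof -
    have "(a * k) \<bullet> (b * k) = Re (cnj (a * k) * (b * k))"
      by (simp add: inner_complex_def algebra_simps)
    also have "cnj (a * k) * (b * k) = cnj a * b * (k * cnj k)"
      by (simp add: mult_ac)
    also have "k * cnj k = 1"
      using that by (simp add: complex_norm_square[symmetric])
    finally show ?thesis
      by (simp add: inner_complex_def)
  qed
  moreover have "cmod (h powi l) = 1" for l
    using assms by (simp add: norm_power_int)
  ultimately show ?thesis
    by (simp add: act_def inner_vec_def)
qed

lemma cplx_structure_act: "cplx_structure (act lam v h) = act lam (cplx_structure v) h"
  by (simp add: cplx_structure_def act_def vec_eq_iff)

text \<open>On the unit circle the complex conjugate is the inverse group element.\<close>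

lemma act_cnj_cancel:
  assumes "cmod h = 1"
  shows "act lam (act lam w (cnj h)) h = w"
proof -
  have h: "cnj h * h = 1"
    using assms by (simp add: complex_norm_square[symmetric] mult.commute[of "cnj h"])
  have "cnj h powi l * h powi l = 1" for l
    unfolding power_int_mult_distrib[symmetric] h by simp
  then show ?thesis
    by (simp add: act_def vec_eq_iff mult.assoc)
qed

text \<open>Differentiating \<open>\<bar>h\<bar>\<^sup>2 = 1\<close> shows that \<open>cnj h \<cdot> h'\<close> is purely imaginary. Its imaginary part is the derivative of the angle,
and using it avoids a choice of logarithm.\<close>

lemma has_derivative_unit_circle:
  fixes h :: "'a::real_normed_vector \<Rightarrow> complex"
  assumes "open U" "u \<in> U" "\<And>x. x \<in> U \<Longrightarrow> cmod (h x) = 1"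
    and "(h has_derivative h') (at u)"
  shows "h' v = \<i> * of_real (Im (cnj (h u) * h' v)) * h u"
proof -
  have "((\<lambda>x. h x \<bullet> h x) has_derivative (\<lambda>v. h u \<bullet> h' v + h' v \<bullet> h u)) (at u)"
    by (intro has_derivative_inner assms)
  moreover have "((\<lambda>x. h x \<bullet> h x) has_derivative (\<lambda>v. 0)) (at u)"
    by (rule has_derivative_transform_within_open[of "\<lambda>x. 1" _ _ _ U])
      (use assms in \<open>auto simp: power2_norm_eq_inner[symmetric]\<close>)
  ultimately have "(\<lambda>v. h u \<bullet> h' v + h' v \<bullet> h u) = (\<lambda>v. 0)"
    by (rule has_derivative_unique)
  then have "Re (cnj (h u) * h' v) = 0"
    by (auto simp: inner_complex_def fun_eq_iff algebra_simps dest: spec[of _ v])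
  then have "cnj (h u) * h' v = \<i> * of_real (Im (cnj (h u) * h' v))"
    by (simp add: complex_eq_iff)
  then have "h u * (cnj (h u) * h' v) = h u * (\<i> * of_real (Im (cnj (h u) * h' v)))"
    by simp
  moreover have "h u * cnj (h u) = 1"
    using assms(2,3) by (simp add: complex_norm_square[symmetric])
  ultimately show ?thesis
    by (simp add: mult.assoc[symmetric] mult.commute)
qed

text \<open>The product rule for a moving vector rotated by a moving group element: the rotation contributes the derivative
of the angle times \<open>\<i> \<lambda>\<^sub>j\<close> in each coordinate. It is applied twice, to the map itself and to its tangent frame.\<close>

lemma has_derivative_act:
  fixes h :: "'a::real_normed_vector \<Rightarrow> complex" and w :: "'a \<Rightarrow> complex^'n"
  assumes "open U" "u \<in> U" "\<And>x. x \<in> U \<Longrightarrow> cmod (h x) = 1"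
    and h: "(h has_derivative h') (at u)" and w: "(w has_derivative w') (at u)"
  shows "((\<lambda>x. act lam (w x) (h x)) has_derivative
      (\<lambda>v. act lam (\<chi> j. w' v $ j + \<i> * of_real (of_int (lam j) * Im (cnj (h u) * h' v)) * w u $ j) (h u))) (at u)"
proof -
  have nz: "h u \<noteq> 0"
    using assms(2,3) by force
  have pow: "((\<lambda>x. h x powi l) has_derivative
      (\<lambda>v. \<i> * of_real (of_int l * Im (cnj (h u) * h' v)) * h u powi l)) (at u)" for l
  proof -
    have "((\<lambda>x. h x powi l) has_derivative (\<lambda>v. h' v * (of_int l * h u powi (l - 1)))) (at u)"
      using nz h by (rule has_derivative_power_int)
    moreover have "h' v * (of_int l * h u powi (l - 1)) =
        \<i> * of_real (of_int l * Im (cnj (h u) * h' v)) * h u powi l" for v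
    proof -
      have pow: "h u powi l = h u powi (l - 1) * h u"
        using nz by (simp add: power_int_diff)
      define t where "t = Im (cnj (h u) * h' v)"
      have "h' v = \<i> * of_real t * h u"
        unfolding t_def by (rule has_derivative_unit_circle[OF assms(1-3) h])
      then show ?thesis
        unfolding pow t_def[symmetric] by (simp add: mult_ac)
    qed
    ultimately show ?thesis by simp
  qed
  have "((\<lambda>x. \<chi> j. w x $ j * h x powi lam j) has_derivative
     (\<lambda>v. \<chi> j. w u $ j * (\<i> * of_real (of_int (lam j) * Im (cnj (h u) * h' v)) * h u powi lam j)
        + w' v $ j * h u powi lam j)) (at u)"
    by (intro has_derivative_vec_lambda has_derivative_mult pow
        bounded_linear.has_derivative[OF bounded_linear_vec_nth] w)
  then show ?thesis
    unfolding act_def by (rule has_derivative_eq_rhs) (simp add: vec_eq_iff fun_eq_iff algebra_simps)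
qed

section \<open>Mean curvature of a real submanifold swept by the circle\<close>

text \<open>A piece of the level set \<open>\<Sum>\<lambda>\<^sub>j y\<^sub>j\<^sup>2 = c\<close> in \<open>\<real>\<^sup>n\<close> together with a phase \<open>h\<close>, both functions of all coordinates. Nothing
separates the coordinates of \<open>y\<close> from that of \<open>h\<close>, so this covers every parametrization of the product of the
level set with the circle.\<close>

locale circle_sweep =
  fixes lam :: "'n::finite \<Rightarrow> int" and U :: "(real^'n) set"
    and y :: "real^'n \<Rightarrow> real^'n" and h :: "real^'n \<Rightarrow> complex" and c :: real
    and f :: "real^'n \<Rightarrow> complex^'n"
  assumes open_U: "open U"
    and y_C2: "Ck_on 2 U y" and h_C2: "Ck_on 2 U h"
    and level: "\<And>u. u \<in> U \<Longrightarrow> (\<Sum>j\<in>UNIV. of_int (lam j) * (y u $ j)\<^sup>2) = c"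
    and unit: "\<And>u. u \<in> U \<Longrightarrow> cmod (h u) = 1"
    and f_eq: "\<And>u. u \<in> U \<Longrightarrow> f u = act lam (cvec (y u)) (h u)"
begin

definition dy :: "real^'n \<Rightarrow> real^'n \<Rightarrow> real^'n" where
  "dy u v = frechet_derivative y (at u) v"

text \<open>The differential of the angle of \<open>h\<close>.\<close>

definition dth :: "real^'n \<Rightarrow> real^'n \<Rightarrow> real" where
  "dth u v = Im (cnj (h u) * frechet_derivative h (at u) v)"

text \<open>Half the gradient of \<open>\<Sum>\<lambda>\<^sub>j y\<^sub>j\<^sup>2\<close>, hence a normal of the level set in \<open>\<real>\<^sup>n\<close>; multiplied by \<open>\<i>\<close>, the generator of the circle
action at \<open>y\<close>.\<close>

definition nu :: "real^'n \<Rightarrow> real^'n" where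
  "nu u = (\<chi> j. of_int (lam j) * y u $ j)"

text \<open>The differential of \<open>f\<close> before the rotation by \<open>h\<close>: its real part is tangent to the level set and its
imaginary part points along the orbit of the circle.\<close>

definition frame :: "real^'n \<Rightarrow> real^'n \<Rightarrow> complex^'n" where
  "frame u v = (\<chi> j. Complex (dy u v $ j) (dth u v * nu u $ j))"

lemma y_deriv: "u \<in> U \<Longrightarrow> (y has_derivative dy u) (at u)"
  using Ck_on_has_derivative[of 1 U y u] y_C2 by (simp add: dy_def[abs_def] numeral_2_eq_2 del: Ck_on.simps)

lemma h_deriv: "u \<in> U \<Longrightarrow> (h has_derivative frechet_derivative h (at u)) (at u)"
  using Ck_on_has_derivative[of 1 U h u] h_C2 by (simp add: numeral_2_eq_2 del: Ck_on.simps)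

lemma Ck_on_dy: "Ck_on (Suc 0) U (\<lambda>u. dy u v)"
  using y_C2 unfolding numeral_2_eq_2 Ck_on.simps(2)[of "Suc 0"] dy_def by blast

lemma Ck_on_dth: "Ck_on (Suc 0) U (\<lambda>u. dth u v)"
proof -
  have "Ck_on (Suc 0) U (\<lambda>u. frechet_derivative h (at u) v)"
    using h_C2 unfolding numeral_2_eq_2 Ck_on.simps(2)[of "Suc 0"] by blast
  moreover have "Ck_on (Suc 0) U (\<lambda>u. cnj (h u))"
    using Ck_on_Suc_imp[of "Suc 0" U h] h_C2 unfolding numeral_2_eq_2
    by (intro Ck_on_linear_compose[OF bounded_linear_cnj open_U])
  ultimately show ?thesis
    unfolding dth_def
    by (intro Ck_on_linear_compose[OF bounded_linear_Im open_U] Ck_on_mult[OF open_U])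
qed

lemma linear_dy: "u \<in> U \<Longrightarrow> linear (dy u)"
  using y_deriv by (rule has_derivative_linear)

lemma linear_dth: "u \<in> U \<Longrightarrow> linear (dth u)"
  using has_derivative_linear[OF h_deriv, of u]
  by (auto simp: dth_def linear_iff algebra_simps)

text \<open>Obtained by differentiating the level equation. This orthogonality is responsible for the Lagrangian condition.\<close>

lemma dy_orthogonal_nu:
  assumes "u \<in> U"
  shows "dy u v \<bullet> nu u = 0"
proof -
  have "((\<lambda>u. \<Sum>j\<in>UNIV. of_int (lam j) * (y u $ j)\<^sup>2) has_derivative
      (\<lambda>v. \<Sum>j\<in>UNIV. of_int (lam j) * (2 * (y u $ j * dy u v $ j)))) (at u)"
    by (rule has_derivative_eq_rhs, rule has_derivative_sum, rule has_derivative_mult_right,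
        rule has_derivative_power[OF has_derivative_nth[OF y_deriv[OF assms]]])
      (simp add: mult_ac)
  moreover have "((\<lambda>u. \<Sum>j\<in>UNIV. of_int (lam j) * (y u $ j)\<^sup>2) has_derivative (\<lambda>v. 0)) (at u)"
    by (rule has_derivative_transform_within_open[of "\<lambda>x. c" _ _ _ U]) (use assms open_U level in auto)
  ultimately have "(\<lambda>v. \<Sum>j\<in>UNIV. of_int (lam j) * (2 * (y u $ j * dy u v $ j))) = (\<lambda>v. 0)"
    by (rule has_derivative_unique)
  then have "2 * (\<Sum>j\<in>UNIV. of_int (lam j) * (y u $ j * dy u v $ j)) = 0"
    by (simp add: sum_distrib_left fun_eq_iff mult_ac)
  then show ?thesis
    by (simp add: inner_vec_def nu_def mult_ac)
qed

lemma f_deriv: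
  assumes "u \<in> U"
  shows "(f has_derivative (\<lambda>v. act lam (frame u v) (h u))) (at u)"
proof -
  have "bounded_linear (cvec :: real^'n \<Rightarrow> complex^'n)"
    by (intro linear_conv_bounded_linear[THEN iffD1] linearI) (simp_all add: cvec_def vec_eq_iff scaleR_conv_of_real[where 'a=complex])
  then have "((\<lambda>u. cvec (y u)) has_derivative (\<lambda>v. cvec (dy u v))) (at u)"
    using y_deriv[OF assms] by (rule bounded_linear.has_derivative)
  from has_derivative_act[OF open_U assms unit h_deriv[OF assms] this, of lam]
  have "((\<lambda>u. act lam (cvec (y u)) (h u)) has_derivative (\<lambda>v. act lam (frame u v) (h u))) (at u)"
    by (rule has_derivative_eq_rhs)
      (auto simp: frame_def cvec_def dth_def nu_def act_def vec_eq_iff fun_eq_iff complex_eq_iff algebra_simps)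
  then show ?thesis
    by (rule has_derivative_transform_within_open[OF _ open_U assms]) (simp add: f_eq)
qed

lemma frechet_f: "u \<in> U \<Longrightarrow> frechet_derivative f (at u) = (\<lambda>v. act lam (frame u v) (h u))"
  using frechet_derivative_at[OF f_deriv] by simp

lemma inner_frame:
  "frame u v \<bullet> frame u w = dy u v \<bullet> dy u w + (nu u \<bullet> nu u) * dth u v * dth u w"
  by (simp add: frame_def inner_vec_def inner_complex_def sum.distrib sum_distrib_left sum_distrib_right mult_ac)

lemma inner_cplx_frame:
  "w \<bullet> cplx_structure (frame u v) = (\<Sum>j\<in>UNIV. Im (w $ j) * dy u v $ j) - dth u v * (\<Sum>j\<in>UNIV. Re (w $ j) * nu u $ j)"
  by (simp add: cplx_structure_def frame_def inner_vec_def inner_complex_def sum_subtractf[symmetric] sum_distrib_left algebra_simps)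

lemma kaehler_frame:
  assumes "u \<in> U"
  shows "frame u v \<bullet> cplx_structure (frame u w) = 0"
proof -
  have "frame u v \<bullet> cplx_structure (frame u w) = dth u v * (nu u \<bullet> dy u w) - dth u w * (dy u v \<bullet> nu u)"
    unfolding inner_cplx_frame by (simp add: frame_def inner_vec_def sum_distrib_left mult_ac)
  then show ?thesis
    using assms by (simp add: dy_orthogonal_nu inner_commute)
qed

lemma kaehler_form_f:
  assumes "u \<in> U"
  shows "kaehler_form (frechet_derivative f (at u) v) (frechet_derivative f (at u) w) = 0"
  unfolding kaehler_form_def frechet_f[OF assms] cplx_structure_act inner_act_act[OF unit[OF assms]]
  using kaehler_frame[OF assms, of w v] by (simp add: inner_commute)

definition ei :: "'n \<Rightarrow> real^'n" where "ei i = axis i 1"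

lemma partial_f: "u \<in> U \<Longrightarrow> partial i f u = act lam (frame u (ei i)) (h u)"
  by (simp add: partial_def frechet_f ei_def)

text \<open>The second fundamental form of a Lagrangian immersion, as the tensor \<open>\<langle>\<partial>\<^sub>k \<partial>\<^sub>i f, I \<partial>\<^sub>m f\<rangle>\<close>. All second derivatives of \<open>y\<close> and
of the angle disappear: those of \<open>y\<close> only occur paired with \<open>nu\<close> and are then expressed by \<open>B\<close>, and those of the angle are
multiplied by \<open>dy \<bullet> nu = 0\<close>.\<close>

lemma cubic_form:
  assumes u: "u \<in> U"
  defines "d \<equiv> \<lambda>i. dy u (ei i)" and "th \<equiv> \<lambda>i. dth u (ei i)"
  defines "B \<equiv> \<lambda>i k. \<Sum>j\<in>UNIV. of_int (lam j) * d i $ j * d k $ j"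
    and "Q \<equiv> \<Sum>j\<in>UNIV. of_int (lam j) * (nu u $ j)\<^sup>2"
  shows "partial k (partial i f) u \<bullet> cplx_structure (partial m f u) =
     B i k * th m + B k m * th i + B i m * th k + Q * th i * th k * th m"
proof -
  let ?a = "frechet_derivative (\<lambda>u. dy u (ei i)) (at u)"
  let ?b = "frechet_derivative (\<lambda>u. dth u (ei i)) (at u)"
  have a: "((\<lambda>u. dy u (ei i)) has_derivative ?a) (at u)"
    by (rule Ck_on_has_derivative[OF Ck_on_dy u])
  have b: "((\<lambda>u. dth u (ei i)) has_derivative ?b) (at u)"
    by (rule Ck_on_has_derivative[OF Ck_on_dth u])
  have nu_d: "((\<lambda>u. nu u $ j) has_derivative (\<lambda>v. of_int (lam j) * dy u v $ j)) (at u)" for j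
    unfolding nu_def vec_lambda_beta
    by (rule has_derivative_mult_right[OF has_derivative_nth[OF y_deriv[OF u]]])
  have cplx: "((\<lambda>x. Complex (p x) (q x)) has_derivative (\<lambda>v. Complex (p' v) (q' v))) (at u)"
    if "(p has_derivative p') (at u)" "(q has_derivative q') (at u)" for p q p' q'
    unfolding Complex_eq
    by (intro has_derivative_add has_derivative_mult_right
        bounded_linear.has_derivative[OF bounded_linear_of_real] that)
  have fr: "((\<lambda>u. frame u (ei i)) has_derivative (\<lambda>v. \<chi> j. Complex (?a v $ j)
      (th i * (of_int (lam j) * dy u v $ j) + ?b v * nu u $ j))) (at u)"
    unfolding frame_def th_def by (intro has_derivative_vec_lambda cplx has_derivative_nth a has_derivative_mult b nu_d)
  have "((\<lambda>x. act lam (frame x (ei i)) (h x)) has_derivative (\<lambda>v. act lam (\<chi> j. Complex (?a v $ j)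
      (th i * (of_int (lam j) * dy u v $ j) + ?b v * nu u $ j) +
      \<i> * of_real (of_int (lam j) * dth u v) * frame u (ei i) $ j) (h u))) (at u)" (is "(_ has_derivative ?D) _")
    by (rule has_derivative_eq_rhs, rule has_derivative_act[OF open_U u unit h_deriv[OF u] fr, of lam])
      (simp_all add: dth_def[of u])
  then have "(partial i f has_derivative ?D) (at u)"
    by (rule has_derivative_transform_within_open[OF _ open_U u]) (simp add: partial_f)
  then have "?D = frechet_derivative (partial i f) (at u)"
    by (rule frechet_derivative_at)
  then have second: "partial k (partial i f) u = ?D (ei k)"
    unfolding partial_def[of k "partial i f" u] ei_def[of k] by (rule fun_cong[OF sym])
  \<comment> \<open>Differentiating \<open>dy \<bullet> nu = 0\<close> removes the second derivatives of \<open>y\<close>.\<close>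
  have "((\<lambda>u. \<Sum>j\<in>UNIV. dy u (ei i) $ j * nu u $ j) has_derivative
      (\<lambda>v. \<Sum>j\<in>UNIV. d i $ j * (of_int (lam j) * dy u v $ j) + ?a v $ j * nu u $ j)) (at u)"
    unfolding d_def by (intro has_derivative_sum has_derivative_mult has_derivative_nth a nu_d)
  moreover have "((\<lambda>u. \<Sum>j\<in>UNIV. dy u (ei i) $ j * nu u $ j) has_derivative (\<lambda>v. 0)) (at u)"
    by (rule has_derivative_transform_within_open[of "\<lambda>x. 0" _ _ _ U])
      (use u open_U dy_orthogonal_nu in \<open>auto simp: inner_vec_def\<close>)
  ultimately have "(\<lambda>v. \<Sum>j\<in>UNIV. d i $ j * (of_int (lam j) * dy u v $ j) + ?a v $ j * nu u $ j) = (\<lambda>v. 0)"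
    by (rule has_derivative_unique)
  from fun_cong[OF this, of "ei k"]
  have tang: "(\<Sum>j\<in>UNIV. ?a (ei k) $ j * nu u $ j) = - B i k"
    by (simp add: sum.distrib B_def d_def algebra_simps)
  have orth: "(\<Sum>j\<in>UNIV. nu u $ j * d m $ j) = 0"
    using dy_orthogonal_nu[OF u, of "ei m"] by (simp add: inner_vec_def d_def mult.commute)
  let ?W = "\<chi> j. Complex (?a (ei k) $ j)
      (th i * (of_int (lam j) * d k $ j) + ?b (ei k) * nu u $ j) +
      \<i> * of_real (of_int (lam j) * th k) * frame u (ei i) $ j"
  have "partial k (partial i f) u \<bullet> cplx_structure (partial m f u) = ?W \<bullet> cplx_structure (frame u (ei m))"
    unfolding second partial_f[OF u] cplx_structure_act inner_act_act[OF unit[OF u]] d_def th_def ..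
  also have "\<dots> = (\<Sum>j\<in>UNIV. (th i * (of_int (lam j) * d k $ j) + ?b (ei k) * nu u $ j
        + of_int (lam j) * th k * d i $ j) * d m $ j)
      - th m * (\<Sum>j\<in>UNIV. (?a (ei k) $ j - of_int (lam j) * th k * (th i * nu u $ j)) * nu u $ j)"
    unfolding inner_cplx_frame by (simp add: frame_def d_def th_def)
  also have "(\<Sum>j\<in>UNIV. (th i * (of_int (lam j) * d k $ j) + ?b (ei k) * nu u $ j
        + of_int (lam j) * th k * d i $ j) * d m $ j) =
      th i * B k m + ?b (ei k) * (\<Sum>j\<in>UNIV. nu u $ j * d m $ j) + th k * B i m"
    by (simp add: B_def distrib_left distrib_right sum.distrib sum_distrib_left mult_ac)
  also have "(\<Sum>j\<in>UNIV. (?a (ei k) $ j - of_int (lam j) * th k * (th i * nu u $ j)) * nu u $ j) =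
      (\<Sum>j\<in>UNIV. ?a (ei k) $ j * nu u $ j) - th k * th i * Q"
    unfolding Q_def sum_distrib_left sum_subtractf[symmetric]
    by (intro sum.cong refl) (simp add: power2_eq_square algebra_simps)
  finally show ?thesis
    unfolding tang orth by (simp add: algebra_simps)
qed

context
  fixes u
  assumes u: "u \<in> U" and nz: "nu u \<noteq> 0"
    and immersive: "\<And>v. dy u v = 0 \<Longrightarrow> dth u v = 0 \<Longrightarrow> v = 0"
begin

lemma linear_frame: "linear (\<lambda>v. act lam (frame u v) (h u))"
  using f_deriv[OF u] by (rule has_derivative_linear)

lemma inj_frechet_f: "inj (frechet_derivative f (at u))"
proof -
  have "v = 0" if "act lam (frame u v) (h u) = 0" for v
  proof -
    have "frame u v \<bullet> frame u v = 0"
      using inner_act_act[OF unit[OF u], of lam "frame u v" "frame u v"] that by simp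
    then have "frame u v = 0" by simp
    then have eq: "dy u v $ j = 0" "dth u v * nu u $ j = 0" for j
      by (simp_all add: frame_def vec_eq_iff complex_eq_iff)
    from eq(1) have "dy u v = 0"
      by (simp add: vec_eq_iff)
    moreover obtain j where "nu u $ j \<noteq> 0"
      using nz by (auto simp: vec_eq_iff)
    ultimately show "v = 0"
      using eq(2)[of j] immersive[of v] by simp
  qed
  then show ?thesis
    unfolding frechet_f[OF u] linear_injective_0[OF linear_frame] by blast
qed

text \<open>Dropping the factor \<open>\<i>\<close> in front of the angular part turns the differential into an endomorphism of \<open>\<real>\<^sup>n\<close>, whose two
summands are orthogonal, so that its kernel is that of the differential. Its invertibility replaces dimension counts
for the tangent and normal spaces.\<close>

lemma inj_shifted: "inj (\<lambda>v. dy u v + dth u v *\<^sub>R nu u)"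
proof -
  have lin: "linear (\<lambda>v. dy u v + dth u v *\<^sub>R nu u)"
    using linear_dy[OF u] linear_dth[OF u] by (simp add: linear_iff algebra_simps)
  have "v = 0" if "dy u v + dth u v *\<^sub>R nu u = 0" for v
  proof -
    have "(dy u v + dth u v *\<^sub>R nu u) \<bullet> nu u = 0"
      using that by simp
    then have "dth u v = 0"
      using nz by (simp add: inner_add_left dy_orthogonal_nu[OF u])
    then show ?thesis
      using that immersive[of v] by simp
  qed
  then show ?thesis
    unfolding linear_injective_0[OF lin] by blast
qed

lemma surj_shifted: obtains v where "dy u v + dth u v *\<^sub>R nu u = z"
proof -
  have "linear (\<lambda>v. dy u v + dth u v *\<^sub>R nu u)"
    using linear_dy[OF u] linear_dth[OF u] by (simp add: linear_iff algebra_simps)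
  then have "surj (\<lambda>v. dy u v + dth u v *\<^sub>R nu u)"
    using inj_shifted by (intro linear_inj_imp_surj)
  then obtain v where "z = dy u v + dth u v *\<^sub>R nu u"
    by (rule surjE)
  then show ?thesis
    by (intro that[of v]) (rule sym)
qed

text \<open>The tangent space and its image under \<open>I\<close> together span \<open>\<complex>\<^sup>n\<close>. With \<open>w = a + \<i> b\<close>, testing against the coordinate vector
that \<open>dy + dth nu\<close> sends to \<open>nu\<close> gives \<open>a \<bullet> nu = b \<bullet> nu = 0\<close>, and then every real vector can be used as a test vector.\<close>

lemma orthogonal_to_complex_tangent_imp_0:
  assumes 1: "\<And>v. w \<bullet> frame u v = 0" and 2: "\<And>v. w \<bullet> cplx_structure (frame u v) = 0"
  shows "w = 0"
proof -
  define a b :: "real^'n" where "a = (\<chi> j. Re (w $ j))" and "b = (\<chi> j. Im (w $ j))"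
  have 1: "a \<bullet> dy u v + dth u v * (b \<bullet> nu u) = 0" for v
    using 1[of v] by (simp add: a_def b_def frame_def inner_vec_def inner_complex_def sum.distrib sum_distrib_left mult_ac)
  have 2: "b \<bullet> dy u v - dth u v * (a \<bullet> nu u) = 0" for v
    using 2[of v, unfolded inner_cplx_frame] by (simp add: a_def b_def inner_vec_def)
  obtain v0 where v0: "dy u v0 + dth u v0 *\<^sub>R nu u = nu u"
    using surj_shifted .
  then have "(dy u v0 + dth u v0 *\<^sub>R nu u) \<bullet> nu u = nu u \<bullet> nu u"
    by simp
  then have th0: "dth u v0 = 1"
    using nz by (simp add: inner_add_left dy_orthogonal_nu[OF u])
  then have "dy u v0 = 0"
    using v0 by simp
  with 1[of v0] 2[of v0] th0 have nu0: "a \<bullet> nu u = 0" "b \<bullet> nu u = 0"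
    by simp_all
  have zero: "a \<bullet> z = 0 \<and> b \<bullet> z = 0" for z
  proof -
    obtain v where v: "dy u v + dth u v *\<^sub>R nu u = z"
      using surj_shifted .
    show ?thesis
      using 1[of v] 2[of v] nu0 by (simp add: v[symmetric] inner_add_right)
  qed
  from zero[of a] zero[of b] have "a = 0" "b = 0"
    by simp_all
  then show ?thesis
    by (simp add: a_def b_def vec_eq_iff complex_eq_iff)
qed

text \<open>Before the rotation the claimed vector is a real multiple of \<open>nu\<close>, hence orthogonal to the frame, and by \<open>weighted_trace\<close> its products
with \<open>I \<partial>\<^sub>m f\<close> agree with those of the mean curvature vector.\<close>

theorem mean_curvature_vector_f:
  "mean_curvature_vector f u =
     act lam (cvec ((- (\<Sum>j\<in>UNIV. of_int (lam j)) / (nu u \<bullet> nu u)) *\<^sub>R nu u)) (h u)"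
proof -
  let ?G = "first_fundamental_form f u" and ?N = "second_fundamental_form f u"
  let ?V = "range (frechet_derivative f (at u))"
  let ?H = "mean_curvature_vector f u"
  let ?c = "- (\<Sum>j\<in>UNIV. of_int (lam j)) / (nu u \<bullet> nu u)"
  let ?R = "cvec (?c *\<^sub>R nu u)"
  note un = unit[OF u]
  have sub: "subspace ?V"
    using linear_subspace_image[OF linear_frame subspace_UNIV] by (simp add: frechet_f[OF u])
  have H: "?H \<bullet> w = (\<Sum>i\<in>UNIV. \<Sum>k\<in>UNIV. matrix_inv ?G $ i $ k * (?N i k \<bullet> w))" for w
    by (simp add: mean_curvature_vector_def inner_sum_left)
  have 1: "?H \<bullet> act lam (frame u v) (h u) = 0" for v
  proof -
    have "?N i k \<bullet> act lam (frame u v) (h u) = 0" for i k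
      using normal_part(1)[OF sub, of "partial i (partial k f) u"]
      by (simp add: second_fundamental_form_def orthogonal_comp_def orthogonal_def frechet_f[OF u] inner_commute)
    then show ?thesis
      unfolding H by simp
  qed
  have coord: "v = (\<Sum>i\<in>UNIV. v $ i *\<^sub>R ei i)" for v :: "real^'n"
    by (simp add: ei_def vec_eq_iff axis_def if_distrib cong: if_cong)
  have dy_sum: "dy u v = (\<Sum>i\<in>UNIV. v $ i *\<^sub>R dy u (ei i))" for v
    using arg_cong[OF coord[of v], of "dy u"]
    by (simp only: linear_sum[OF linear_dy[OF u]] linear_scale[OF linear_dy[OF u]])
  have dth_sum: "dth u v = (\<Sum>i\<in>UNIV. v $ i * dth u (ei i))" for v
    using arg_cong[OF coord[of v], of "dth u"]
    by (simp only: linear_sum[OF linear_dth[OF u]] linear_scale[OF linear_dth[OF u]] real_scaleR_def)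
  have shifted: "(\<Sum>i\<in>UNIV. v $ i *\<^sub>R (dy u (ei i) + dth u (ei i) *\<^sub>R nu u)) = dy u v + dth u v *\<^sub>R nu u" for v
    by (subst dy_sum[of v], subst dth_sum[of v])
      (simp only: scaleR_add_right sum.distrib scaleR_sum_left scaleR_scaleR)
  have inj: "inj (\<lambda>v::real^'n. \<Sum>i\<in>UNIV. v $ i *\<^sub>R (dy u (ei i) + dth u (ei i) *\<^sub>R nu u))"
    unfolding shifted by (rule inj_shifted)
  have G: "?G = (\<chi> i k. dy u (ei i) \<bullet> dy u (ei k) + (nu u \<bullet> nu u) * dth u (ei i) * dth u (ei k))"
    by (simp add: first_fundamental_form_def partial_f[OF u] inner_act_act[OF un] inner_frame)
  have 2: "?H \<bullet> act lam (cplx_structure (frame u (ei m))) (h u) =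
      (\<Sum>j\<in>UNIV. of_int (lam j)) * dth u (ei m)" for m
  proof -
    \<comment> \<open>Passing to the normal part changes nothing, because \<open>I \<partial>\<^sub>m f\<close> is normal.\<close>
    have "?N i k \<bullet> act lam (cplx_structure (frame u (ei m))) (h u) =
        partial i (partial k f) u \<bullet> cplx_structure (partial m f u)" for i k
    proof -
      obtain v where "partial i (partial k f) u - ?N i k = act lam (frame u v) (h u)"
        using normal_part(2)[OF sub, of "partial i (partial k f) u"]
        by (auto simp: second_fundamental_form_def frechet_f[OF u])
      then have "(partial i (partial k f) u - ?N i k) \<bullet> act lam (cplx_structure (frame u (ei m))) (h u) = 0"
        by (simp add: inner_act_act[OF un] kaehler_frame[OF u])
      then show ?thesis
        by (simp add: inner_diff_left partial_f[OF u] cplx_structure_act)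
    qed
    also have "partial i (partial k f) u \<bullet> cplx_structure (partial m f u) =
        (\<Sum>j\<in>UNIV. of_int (lam j) * dy u (ei i) $ j * dy u (ei k) $ j) * dth u (ei m) +
        (\<Sum>j\<in>UNIV. of_int (lam j) * dy u (ei k) $ j * dy u (ei m) $ j) * dth u (ei i) +
        (\<Sum>j\<in>UNIV. of_int (lam j) * dy u (ei i) $ j * dy u (ei m) $ j) * dth u (ei k) +
        (\<Sum>j\<in>UNIV. of_int (lam j) * (nu u $ j)\<^sup>2) * dth u (ei i) * dth u (ei k) * dth u (ei m)" for i k
      unfolding cubic_form[OF u] by (simp only: mult_ac add_ac)
    finally show ?thesis
      unfolding H G by (simp only: weighted_trace[OF nz dy_orthogonal_nu[OF u] inj])
  qed
  \<comment> \<open>The mean curvature vector before the rotation by \<open>h\<close>.\<close>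
  define w where "w = act lam ?H (cnj (h u))"
  have w: "act lam w (h u) = ?H"
    unfolding w_def by (rule act_cnj_cancel[OF un])
  have real_frame: "cvec (r *\<^sub>R nu u) \<bullet> frame u v = 0" for r v
  proof -
    have "cvec (r *\<^sub>R nu u) \<bullet> frame u v = r * (dy u v \<bullet> nu u)"
      by (simp add: cvec_def frame_def inner_vec_def inner_complex_def sum_distrib_left mult_ac)
    then show ?thesis
      by (simp add: dy_orthogonal_nu[OF u])
  qed
  have real_cplx_frame: "cvec (r *\<^sub>R nu u) \<bullet> cplx_structure (frame u v) = - (dth u v * (r * (nu u \<bullet> nu u)))" for r v
    unfolding inner_cplx_frame by (simp add: cvec_def inner_vec_def sum_distrib_left mult_ac)
  have "w - ?R = 0"
  proof (rule orthogonal_to_complex_tangent_imp_0)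
    fix v
    have "w \<bullet> frame u v = 0"
      using 1[of v] by (simp add: w[symmetric] inner_act_act[OF un])
    then show "(w - ?R) \<bullet> frame u v = 0"
      unfolding inner_diff_left real_frame by simp
    have "w \<bullet> cplx_structure (frame u (ei m)) = (\<Sum>j\<in>UNIV. of_int (lam j)) * dth u (ei m)" for m
      using 2[of m] by (simp add: w[symmetric] inner_act_act[OF un])
    then have base: "(w - ?R) \<bullet> cplx_structure (frame u (ei m)) = 0" for m
      unfolding inner_diff_left real_cplx_frame using nz by simp
    have "frame u v = (\<Sum>i\<in>UNIV. v $ i *\<^sub>R frame u (ei i))"
      by (simp add: frame_def vec_eq_iff complex_eq_iff dy_sum[of v] dth_sum[of v] sum_distrib_left mult_ac)
    then have "cplx_structure (frame u v) = (\<Sum>i\<in>UNIV. v $ i *\<^sub>R cplx_structure (frame u (ei i)))"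
      by (simp add: cplx_structure_def vec_eq_iff sum_distrib_left mult_ac)
    then show "(w - ?R) \<bullet> cplx_structure (frame u v) = 0"
      by (simp only: inner_sum_right inner_scaleR_right base mult_zero_right sum.neutral_const)
  qed
  then show ?thesis
    using w by simp
qed

end

end

section \<open>Moving along an orbit to a prescribed level of the moment map\<close>

text \<open>The restriction of the moment map to the real vectors.\<close>

definition height :: "('n::finite \<Rightarrow> int) \<Rightarrow> real^'n \<Rightarrow> real" where
  "height lam x = (1/2) * (\<Sum>i\<in>UNIV. of_int (lam i) * (x $ i)\<^sup>2)"

text \<open>The action of the noncompact factor of the complexified circle; its orbits carry the integral curves.\<close>

definition dilate :: "('n::finite \<Rightarrow> int) \<Rightarrow> real \<Rightarrow> real^'n \<Rightarrow> real^'n" where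
  "dilate lam s x = (\<chi> i. exp (- of_int (lam i) * s) * x $ i)"

definition generator_sqnorm :: "('n::finite \<Rightarrow> int) \<Rightarrow> real^'n \<Rightarrow> real" where
  "generator_sqnorm lam x = (\<Sum>i\<in>UNIV. (of_int (lam i) * x $ i)\<^sup>2)"

text \<open>The parameter at which the orbit of the second component crosses the level given by the first one.\<close>

definition level_time :: "('n::finite \<Rightarrow> int) \<Rightarrow> real \<times> (real^'n) \<Rightarrow> real" where
  "level_time lam q = (THE s. height lam (dilate lam s (snd q)) = fst q)"

abbreviation orbit_point :: "('n::finite \<Rightarrow> int) \<Rightarrow> real \<Rightarrow> real^'n \<Rightarrow> real^'n" where
  "orbit_point lam c x \<equiv> dilate lam (level_time lam (c, x)) x"

definition reachable :: "('n::finite \<Rightarrow> int) \<Rightarrow> (real \<times> (real^'n)) set" where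
  "reachable lam = {(c, x). x \<noteq> 0 \<and> (\<exists>s. height lam (dilate lam s x) = c)}"

lemma dilate_0 [simp]: "dilate lam 0 x = x"
  by (simp add: dilate_def vec_eq_iff)

lemma dilate_eq_0_iff [simp]: "dilate lam s x = 0 \<longleftrightarrow> x = 0"
  by (simp add: dilate_def vec_eq_iff)

lemma generator_sqnorm_pos:
  assumes "\<forall>i. lam i \<noteq> 0" "x \<noteq> 0"
  shows "0 < generator_sqnorm lam x"
proof -
  obtain i where "x $ i \<noteq> 0"
    using assms(2) by (auto simp: vec_eq_iff)
  then have "0 < (of_int (lam i) * x $ i)\<^sup>2"
    using assms(1) by simp
  also have "\<dots> \<le> generator_sqnorm lam x"
    unfolding generator_sqnorm_def by (rule member_le_sum) auto
  finally show ?thesis .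
qed

text \<open>The derivative in the orbit direction is minus the squared length of the generator. It is nonzero at nonzero points,
and this is what makes the crossing parameter unique and smooth.\<close>

lemma has_derivative_height_dilate:
  fixes x :: "real^'n"
  shows "((\<lambda>p. height lam (dilate lam (fst p) (snd p))) has_derivative
     (\<lambda>v. (\<Sum>i\<in>UNIV. of_int (lam i) * dilate lam s x $ i * dilate lam s (snd v) $ i) - fst v * generator_sqnorm lam (dilate lam s x)))
   (at (s, x))"
proof -
  have c: "((\<lambda>p. (snd p :: real^'n) $ i) has_derivative (\<lambda>v. snd v $ i)) (at (s, x))" for i
    by (intro bounded_linear.has_derivative[OF bounded_linear_vec_nth] has_derivative_snd has_derivative_ident)
  have e: "((\<lambda>p::real \<times> (real^'n). exp (- of_int (lam i) * fst p)) has_derivative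
      (\<lambda>v. exp (- of_int (lam i) * s) * (- of_int (lam i) * fst v))) (at (s, x))" for i
    by (rule has_derivative_eq_rhs, rule has_derivative_exp, rule has_derivative_mult_right,
        rule has_derivative_fst, rule has_derivative_ident) (simp add: mult_ac)
  have "((\<lambda>p. (1/2) * (\<Sum>i\<in>UNIV. of_int (lam i) * (exp (- of_int (lam i) * fst p) * (snd p :: real^'n) $ i)\<^sup>2)) has_derivative
     (\<lambda>v. (1/2) * (\<Sum>i\<in>UNIV. of_int (lam i) * (of_nat 2 * (exp (- of_int (lam i) * s) * snd v $ i
         + exp (- of_int (lam i) * s) * (- of_int (lam i) * fst v) * x $ i) *
        (exp (- of_int (lam i) * s) * x $ i) ^ (2 - 1))))) (at (s, x))"
    by (rule has_derivative_eq_rhs, rule has_derivative_mult_right, rule has_derivative_sum,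
        rule has_derivative_mult_right, rule has_derivative_power, rule has_derivative_mult[OF e c]) simp
  then show ?thesis
    unfolding height_def dilate_def vec_lambda_beta
    by (rule has_derivative_eq_rhs)
      (simp add: fun_eq_iff generator_sqnorm_def sum_distrib_left sum_subtractf[symmetric] power2_eq_square algebra_simps)
qed

lemma height_dilate_strict_decreasing:
  assumes lam: "\<forall>i. lam i \<noteq> 0" and x: "x \<noteq> 0" and "s < s'"
  shows "height lam (dilate lam s' x) < height lam (dilate lam s x)"
proof (rule DERIV_neg_imp_decreasing[OF \<open>s < s'\<close>])
  fix r :: real
  have "((\<lambda>r. (r, x)) has_derivative (\<lambda>v. (v, 0))) (at r)"
    by (intro has_derivative_Pair has_derivative_ident has_derivative_const)
  then have "((\<lambda>r. (\<lambda>p. height lam (dilate lam (fst p) (snd p))) (r, x)) has_derivative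
     (\<lambda>v. (\<lambda>v. (\<Sum>i\<in>UNIV. of_int (lam i) * dilate lam r x $ i * dilate lam r (snd v) $ i)
        - fst v * generator_sqnorm lam (dilate lam r x)) (v, 0))) (at r)"
    by (rule has_derivative_compose) (rule has_derivative_height_dilate)
  then have "((\<lambda>r. height lam (dilate lam r x)) has_real_derivative - generator_sqnorm lam (dilate lam r x)) (at r)"
    unfolding has_field_derivative_def fst_conv snd_conv
    by (rule has_derivative_eq_rhs) (simp add: fun_eq_iff dilate_def mult_ac)
  then show "\<exists>y. ((\<lambda>r. height lam (dilate lam r x)) has_real_derivative y) (at r) \<and> y < 0"
    using generator_sqnorm_pos[OF lam, of "dilate lam r x"] x by auto
qed

lemma height_dilate_inj:
  assumes "\<forall>i. lam i \<noteq> 0" "x \<noteq> 0" "height lam (dilate lam s x) = height lam (dilate lam s' x)"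
  shows "s = s'"
  using height_dilate_strict_decreasing[OF assms(1,2), of s s'] height_dilate_strict_decreasing[OF assms(1,2), of s' s]
    assms(3) by (cases s s' rule: linorder_cases) auto

lemma level_time_eqI:
  assumes "\<forall>i. lam i \<noteq> 0" "x \<noteq> 0" "height lam (dilate lam s x) = c"
  shows "level_time lam (c, x) = s"
  unfolding level_time_def using assms height_dilate_inj[of lam x] by (intro the_equality) auto

lemma height_dilate_level_time:
  assumes "\<forall>i. lam i \<noteq> 0" "(c, x) \<in> reachable lam"
  shows "height lam (orbit_point lam c x) = c"
  using assms level_time_eqI[of lam x] by (auto simp: reachable_def)

lemma reachable_eq_image: "reachable lam = (\<lambda>p. (height lam (dilate lam (fst p) (snd p)), snd p)) ` (UNIV \<times> - {0})"
  by (force simp: reachable_def)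

lemma continuous_on_height_dilate:
  fixes S :: "(real \<times> (real^'n)) set"
  shows "continuous_on S (\<lambda>p. (height lam (dilate lam (fst p) (snd p)), snd p))"
proof (intro continuous_on_Pair continuous_on_snd continuous_on_id continuous_at_imp_continuous_on ballI)
  fix p :: "real \<times> (real^'n)"
  show "isCont (\<lambda>p. height lam (dilate lam (fst p) (snd p))) p"
    using has_derivative_continuous[OF has_derivative_height_dilate, of "fst p" "snd p"] by simp
qed

text \<open>The map \<open>(s, x) \<mapsto> (height of the point s on the orbit of x, x)\<close> is continuous and injective between spaces of equal dimension,
so invariance of domain applies to it.\<close>

lemma open_reachable:
  assumes lam: "\<forall>i. lam i \<noteq> 0"
  shows "open (reachable lam)"
  unfolding reachable_eq_image
proof (rule invariance_of_domain)
  show "inj_on (\<lambda>p. (height lam (dilate lam (fst p) (snd p)), snd p)) (UNIV \<times> - {0})"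
    using height_dilate_inj[OF lam] by (auto simp: inj_on_def)
qed (auto intro!: open_Times open_Compl simp: continuous_on_height_dilate)

text \<open>\<open>level_time\<close> is the first component of the inverse of \<open>(s, x) \<mapsto> (height of the point s on the orbit of x, x)\<close>, so its derivative
comes from solving the linearized equation for the first component.\<close>

lemma has_derivative_level_time:
  assumes lam: "\<forall>i. lam i \<noteq> 0" and q: "q \<in> reachable lam"
  defines "y \<equiv> dilate lam (level_time lam q) (snd q)"
  shows "(level_time lam has_derivative (\<lambda>v. ((\<Sum>i\<in>UNIV. of_int (lam i) * y $ i * dilate lam (level_time lam q) (snd v) $ i) - fst v)
            * inverse (generator_sqnorm lam y))) (at q)"
proof -
  obtain s x where sx: "x \<noteq> 0" "q = (height lam (dilate lam s x), x)"
    using q by (auto simp: reachable_def)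
  have st: "level_time lam q = s"
    using level_time_eqI[OF lam sx(1) refl] sx(2) by simp
  have y: "y = dilate lam s x"
    unfolding y_def st using sx(2) by simp
  have pos: "generator_sqnorm lam y > 0"
    unfolding y using generator_sqnorm_pos[OF lam] sx(1) by simp
  let ?F = "\<lambda>p. (height lam (dilate lam (fst p) (snd p)), snd p)"
  let ?l = "\<lambda>\<xi>. \<Sum>i\<in>UNIV. of_int (lam i) * y $ i * dilate lam s \<xi> $ i"
  let ?F' = "\<lambda>v. (?l (snd v) - fst v * generator_sqnorm lam y, snd v)"
  let ?g' = "\<lambda>v. ((?l (snd v) - fst v) * inverse (generator_sqnorm lam y), snd v)"
  have "(?F has_derivative ?F') (at (s, x))"
    unfolding y by (intro has_derivative_Pair has_derivative_snd has_derivative_ident has_derivative_height_dilate)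
  moreover have "?F' \<circ> ?g' = id"
    using pos by (simp add: fun_eq_iff mult.assoc)
  ultimately have "((\<lambda>q. (level_time lam q, snd q)) has_derivative ?g') (at (?F (s, x)))"
    by (intro has_derivative_inverse_strong[where S = "UNIV \<times> - {0}" and f = ?F] continuous_on_height_dilate)
      (use sx level_time_eqI[OF lam] in \<open>auto intro!: open_Times open_Compl\<close>)
  from has_derivative_fst[OF this] show ?thesis
    by (simp add: sx(2)[symmetric] st)
qed

lemma Ck_on_dilate:
  assumes "open S" "Ck_on k S g" "Ck_on k S f"
  shows "Ck_on k S (\<lambda>q. dilate lam (g q) (f q))"
  unfolding dilate_def
  by (intro Ck_on_vec_lambda Ck_on_mult assms Ck_on_vec_nth Ck_on_compose[OF _ Ck_on_exp, where R = UNIV] Ck_on_const) auto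

text \<open>The formula for the derivative involves \<open>level_time\<close> itself only through smooth functions, so each order of
differentiability yields the next.\<close>

lemma Ck_on_level_time:
  fixes lam :: "'n::finite \<Rightarrow> int"
  assumes lam: "\<forall>i. lam i \<noteq> 0"
  shows "Ck_on k (reachable lam) (level_time lam)"
proof (induction k)
  case 0
  show ?case
    using has_derivative_continuous[OF has_derivative_level_time[OF lam]]
    by (auto intro!: continuous_at_imp_continuous_on)
next
  case (Suc k)
  note o = open_reachable[OF lam]
  have snd: "Ck_on k (reachable lam) snd"
    by (rule Ck_on_linear[OF bounded_linear_snd])
  note y = Ck_on_dilate[OF o Suc snd, of lam]
  show ?case
  proof (rule Ck_on_SucI[OF o has_derivative_level_time[OF lam]])
    fix v :: "real \<times> (real^'n)"
    have "Ck_on k (reachable lam) (\<lambda>q. generator_sqnorm lam (dilate lam (level_time lam q) (snd q)))"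
      unfolding generator_sqnorm_def by (intro Ck_on_sum Ck_on_power Ck_on_mult Ck_on_const Ck_on_vec_nth o y)
    moreover have "generator_sqnorm lam (dilate lam (level_time lam q) (snd q)) \<in> - {0}" if "q \<in> reachable lam" for q
      using generator_sqnorm_pos[OF lam, of "dilate lam (level_time lam q) (snd q)"] that by (auto simp: reachable_def)
    ultimately have 1: "Ck_on k (reachable lam) (\<lambda>q. inverse (generator_sqnorm lam (dilate lam (level_time lam q) (snd q))))"
      by (rule Ck_on_compose[OF o Ck_on_inverse])
    have 2: "Ck_on k (reachable lam) (\<lambda>q. \<Sum>i\<in>UNIV. of_int (lam i) * dilate lam (level_time lam q) (snd q) $ i *
        dilate lam (level_time lam q) (snd v) $ i)"
      by (intro Ck_on_sum Ck_on_mult Ck_on_const Ck_on_vec_nth o y Ck_on_dilate[OF o Suc Ck_on_const])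
    have 3: "Ck_on k (reachable lam) (\<lambda>q. (\<Sum>i\<in>UNIV. of_int (lam i) * dilate lam (level_time lam q) (snd q) $ i *
        dilate lam (level_time lam q) (snd v) $ i) + - fst v)"
      by (intro Ck_on_add o 2 Ck_on_const)
    show "Ck_on k (reachable lam) (\<lambda>q. ((\<Sum>i\<in>UNIV. of_int (lam i) * dilate lam (level_time lam q) (snd q) $ i *
        dilate lam (level_time lam q) (snd v) $ i) - fst v) * inverse (generator_sqnorm lam (dilate lam (level_time lam q) (snd q))))"
      using Ck_on_mult[OF o 3 1] by simp
  qed
qed

lemma height_uminus: "height (\<lambda>i. - lam i) x = - height lam x"
  by (simp add: height_def sum_negf)

lemma dilate_uminus: "dilate (\<lambda>i. - lam i) s x = dilate lam (- s) x"
  by (simp add: dilate_def)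

text \<open>A positive height requires a coordinate of positive weight. It makes the height tend to infinity in one direction
of the orbit, while in the other direction all positive contributions die out. The intermediate value theorem gives
every positive level.\<close>

lemma height_dilate_attains_pos:
  fixes x :: "real^'n"
  assumes "0 < height lam x" "0 < c"
  shows "\<exists>s. height lam (dilate lam s x) = c"
proof -
  \<comment> \<open>For \<open>s \<longrightarrow> \<infinity>\<close> only the nonpositive terms survive.\<close>
  let ?t = "\<lambda>i s. (1/2) * (of_int (lam i) * (exp (- of_int (lam i) * s) * x $ i)\<^sup>2)"
  have sum: "height lam (dilate lam s x) = (\<Sum>i\<in>UNIV. ?t i s)" for s
    by (simp add: height_def dilate_def sum_distrib_left)
  define A where "A = {i. lam i > 0}"
  have up: "(\<Sum>i\<in>UNIV. ?t i s) \<le> (\<Sum>i\<in>A. ?t i s)" for s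
  proof -
    have "(\<Sum>i\<in>UNIV. ?t i s) = (\<Sum>i\<in>A. ?t i s) + (\<Sum>i\<in>-A. ?t i s)"
      by (simp add: sum.Int_Diff[of UNIV _ A] Compl_eq_Diff_UNIV)
    moreover have "(\<Sum>i\<in>-A. ?t i s) \<le> 0"
      by (intro sum_nonpos) (auto simp: A_def mult_nonpos_nonneg)
    ultimately show ?thesis by simp
  qed
  have "((\<lambda>s. \<Sum>i\<in>A. ?t i s) \<longlongrightarrow> (\<Sum>i\<in>A. (1/2) * (of_int (lam i) * (0 * x $ i)\<^sup>2))) at_top"
  proof (intro tendsto_intros)
    fix i assume "i \<in> A"
    then have "filterlim (\<lambda>s::real. - of_int (lam i) * s) at_bot at_top"
      by (intro filterlim_tendsto_neg_mult_at_bot[OF tendsto_const _ filterlim_ident]) (auto simp: A_def)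
    then show "((\<lambda>s. exp (- of_int (lam i) * s)) \<longlongrightarrow> (0::real)) at_top"
      by (rule filterlim_compose[OF exp_at_bot])
  qed
  then have "\<forall>\<^sub>F s in at_top. (\<Sum>i\<in>A. ?t i s) < c"
    using order_tendstoD(2)[of _ 0 at_top c] assms(2) by simp
  then obtain s2 where s2: "(\<Sum>i\<in>A. ?t i s2) < c"
    using eventually_happens'[OF trivial_limit_at_top_linorder] by blast
  obtain j where j: "0 < ?t j 0"
  proof -
    have "\<exists>j. 0 < ?t j 0"
    proof (rule ccontr)
      assume "\<not> ?thesis"
      then have "(\<Sum>i\<in>UNIV. ?t i 0) \<le> 0"
        by (intro sum_nonpos) (auto simp: not_less)
      then show False
        using sum[of 0] assms(1) by simp
    qed
    then show ?thesis using that by blast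
  qed
  then have lj: "lam j > 0" and xj: "x $ j \<noteq> 0"
    by (auto simp: zero_less_mult_iff)
  \<comment> \<open>For \<open>s \<longrightarrow> -\<infinity>\<close> one positive term is unbounded, while the negative ones are bounded below.\<close>
  have low: "?t i s \<ge> - \<bar>?t i 0\<bar>" if "s \<le> 0" for i s
  proof (cases "lam i > 0")
    case True
    then have "0 \<le> ?t i s" by simp
    then show ?thesis by linarith
  next
    case False
    have e: "exp (- of_int (lam i) * s) \<le> 1"
      using False that by (simp add: mult_nonpos_nonpos)
    then have "(exp (- of_int (lam i) * s) * x $ i)\<^sup>2 \<le> (x $ i)\<^sup>2"
      unfolding power_mult_distrib by (intro mult_left_le_one_le) (auto simp: power_le_one)
    then have "of_int (lam i) * (x $ i)\<^sup>2 \<le> of_int (lam i) * (exp (- of_int (lam i) * s) * x $ i)\<^sup>2"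
      using False by (intro mult_left_mono_neg) auto
    then have "?t i 0 \<le> ?t i s" by simp
    then show ?thesis by linarith
  qed
  have "filterlim (\<lambda>s. ?t j s) at_top at_bot"
  proof -
    have "filterlim (\<lambda>s::real. - of_int (lam j) * s) at_top at_bot"
      using lj filterlim_tendsto_pos_mult_at_top[OF tendsto_const _ filterlim_uminus_at_top_at_bot, of "of_int (lam j)"]
      by simp
    then have "filterlim (\<lambda>s. exp (- of_int (lam j) * s) :: real) at_top at_bot"
      by (rule filterlim_compose[OF exp_at_top])
    then have "filterlim (\<lambda>s. (1/2 * of_int (lam j) * (x $ j)\<^sup>2) * (exp (- of_int (lam j) * s)) ^ 2) at_top at_bot"
      using lj xj by (intro filterlim_tendsto_pos_mult_at_top[OF tendsto_const] filterlim_pow_at_top) auto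
    then show ?thesis
      by (simp add: power_mult_distrib mult_ac)
  qed
  then have "\<forall>\<^sub>F s in at_bot. ?t j s > c + (\<Sum>i\<in>UNIV. \<bar>?t i 0\<bar>) \<and> s \<le> 0"
    unfolding filterlim_at_top_dense by (intro eventually_conj eventually_le_at_bot) blast
  then obtain s1 where s1: "?t j s1 > c + (\<Sum>i\<in>UNIV. \<bar>?t i 0\<bar>)" "s1 \<le> 0"
    using eventually_happens'[OF trivial_limit_at_bot_linorder] by blast
  have "(\<Sum>i\<in>UNIV. ?t i s1) = ?t j s1 + (\<Sum>i\<in>-{j}. ?t i s1)"
    by (simp add: sum.remove[of UNIV j] Compl_eq_Diff_UNIV)
  moreover have "(\<Sum>i\<in>-{j}. ?t i s1) \<ge> (\<Sum>i\<in>-{j}. - \<bar>?t i 0\<bar>)"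
    using low[OF s1(2)] by (intro sum_mono)
  moreover have "(\<Sum>i\<in>-{j}. \<bar>?t i 0\<bar>) \<le> (\<Sum>i\<in>UNIV. \<bar>?t i 0\<bar>)"
    by (intro sum_mono2) auto
  ultimately have s1': "c \<le> height lam (dilate lam s1 x)"
    using s1(1) unfolding sum sum_negf by linarith
  have s2': "height lam (dilate lam s2 x) \<le> c"
    using up[of s2] s2 unfolding sum by linarith
  have cont: "isCont (\<lambda>s. height lam (dilate lam s x)) s" for s
    unfolding sum by (intro continuous_intros)
  show ?thesis
  proof (cases "s1 \<le> s2")
    case True
    then show ?thesis
      using IVT2[of "\<lambda>s. height lam (dilate lam s x)" s2 c s1] s1' s2' cont by blast
  next
    case False
    then show ?thesis
      using IVT[of "\<lambda>s. height lam (dilate lam s x)" s2 c s1] s1' s2' cont by auto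
  qed
qed

text \<open>Reversing all weights exchanges the two directions of the orbit and the sign of the height.\<close>

lemma height_dilate_attains:
  fixes x :: "real^'n"
  assumes "0 < height lam x * c"
  shows "\<exists>s. height lam (dilate lam s x) = c"
proof (cases "0 < c")
  case True
  then show ?thesis
    using assms height_dilate_attains_pos[of lam x c] by (simp add: zero_less_mult_iff)
next
  case False
  then have "0 < height (\<lambda>i. - lam i) x" "0 < - c"
    using assms by (auto simp: height_uminus zero_less_mult_iff)
  from height_dilate_attains_pos[OF this] show ?thesis
    by (auto simp: height_uminus dilate_uminus)
qed

section \<open>Integral curves of the vector field\<close>

definition re_vec :: "complex^'n \<Rightarrow> real^'n" where
  "re_vec z = (\<chi> i. Re (z $ i))"

lemma re_vec_cvec [simp]: "re_vec (cvec x) = x"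
  by (simp add: re_vec_def cvec_def vec_eq_iff)

lemma bounded_linear_re_vec: "bounded_linear re_vec"
  by (intro linear_conv_bounded_linear[THEN iffD1] linearI) (simp_all add: re_vec_def vec_eq_iff)

lemma bounded_linear_cvec: "bounded_linear cvec"
  by (intro linear_conv_bounded_linear[THEN iffD1] linearI)
    (simp_all add: cvec_def vec_eq_iff scaleR_conv_of_real[where 'a=complex])

lemma punctured_real_space_iff:
  "z \<in> punctured_real_space \<longleftrightarrow> z = cvec (re_vec z) \<and> re_vec z \<noteq> 0"
proof -
  have "(\<forall>i. z $ i \<in> \<real>) \<longleftrightarrow> z = cvec (re_vec z)"
    by (simp add: cvec_def re_vec_def vec_eq_iff complex_is_Real_iff complex_eq_iff)
  moreover have "z = 0 \<longleftrightarrow> re_vec z = 0" if "z = cvec (re_vec z)"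
    by (subst that) (auto simp: cvec_def vec_eq_iff re_vec_def)
  ultimately show ?thesis
    unfolding punctured_real_space_def by blast
qed

lemma cvec_in_punctured_real_space: "x \<noteq> 0 \<Longrightarrow> cvec x \<in> punctured_real_space"
  by (simp add: punctured_real_space_iff)

lemma moment_map_cvec: "moment_map lam (cvec x) = height lam x"
  by (simp add: moment_map_def height_def cvec_def)

lemma generator_sqnorm_eq_inner: "generator_sqnorm lam x = (\<chi> j. of_int (lam j) * x $ j) \<bullet> (\<chi> j. of_int (lam j) * x $ j)"
  by (simp add: generator_sqnorm_def inner_vec_def power2_eq_square)

lemma generated_vf: "generated_vf lam \<xi> z = (\<chi> j. \<i> * of_real (of_int (lam j) * \<xi>) * z $ j)"
proof -
  have "((\<lambda>t. cis (t * \<xi>)) has_derivative (\<lambda>v. (v * \<xi>) *\<^sub>R (\<i> * cis (0 * \<xi>)))) (at 0)"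
    by (intro has_derivative_cis has_derivative_mult_left has_derivative_ident)
  from has_derivative_act[OF open_UNIV UNIV_I norm_cis this has_derivative_const[of z], of lam]
  have "((\<lambda>t. act lam z (cis (t * \<xi>))) has_vector_derivative
      (\<chi> j. \<i> * of_real (of_int (lam j) * \<xi>) * z $ j)) (at 0)"
    unfolding has_vector_derivative_def
    by (rule has_derivative_eq_rhs)
      (simp_all add: fun_eq_iff vec_eq_iff act_def scaleR_conv_of_real[where 'a=complex] mult_ac)
  then show ?thesis
    unfolding generated_vf_def by (rule vector_derivative_at)
qed

lemma xi_tilde_cvec:
  assumes "\<forall>i. lam i \<noteq> 0" "x \<noteq> 0"
  shows "xi_tilde lam (cvec x) = a_H lam / generator_sqnorm lam x"
proof -
  have eq: "generated_vf lam \<xi> (cvec x) \<bullet> generated_vf lam \<eta> (cvec x) = \<xi> * \<eta> * generator_sqnorm lam x" for \<xi> \<eta>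
    by (simp add: generated_vf cvec_def inner_vec_def inner_complex_def generator_sqnorm_def sum_distrib_left power2_eq_square mult_ac)
  have pos: "generator_sqnorm lam x > 0"
    using assms by (rule generator_sqnorm_pos)
  show ?thesis
    unfolding xi_tilde_def eq
  proof (rule the_equality)
    show "\<forall>\<eta>. a_H lam / generator_sqnorm lam x * \<eta> * generator_sqnorm lam x = a_H lam * \<eta>"
      using pos by simp
    fix \<xi> assume "\<forall>\<eta>. \<xi> * \<eta> * generator_sqnorm lam x = a_H lam * \<eta>"
    from this[rule_format, of 1] show "\<xi> = a_H lam / generator_sqnorm lam x"
      using pos by (simp add: field_simps)
  qed
qed

lemma chi_vf_cvec:
  assumes "\<forall>i. lam i \<noteq> 0" "x \<noteq> 0"
  shows "chi_vf lam (cvec x) = cvec ((- a_H lam / generator_sqnorm lam x) *\<^sub>R (\<chi> j. of_int (lam j) * x $ j))"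
  unfolding chi_vf_def xi_tilde_cvec[OF assms] generated_vf
  by (simp add: cplx_structure_def cvec_def vec_eq_iff complex_eq_iff)

text \<open>Along the points of prescribed height \<open>c\<^sub>0 - t a\<close> the orbit parameter has speed \<open>a\<close> divided by the squared length of the
generator, which is the factor in \<open>\<chi>\<close>.\<close>

lemma has_vector_derivative_flow:
  fixes x :: "real^'n"
  assumes lam: "\<forall>i. lam i \<noteq> 0" and r: "(c0 - t * a, x) \<in> reachable lam"
  defines "y \<equiv> \<lambda>t. orbit_point lam (c0 - t * a) x"
  shows "(y has_vector_derivative ((- a / generator_sqnorm lam (y t)) *\<^sub>R (\<chi> j. of_int (lam j) * y t $ j))) (at t)"
proof -
  let ?s = "\<lambda>t. level_time lam (c0 - t * a, x)"
  have "((\<lambda>t. (c0 - t * a, x)) has_derivative (\<lambda>v. (- (v * a), 0))) (at t)"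
    by (intro has_derivative_Pair has_derivative_const) (auto intro!: derivative_eq_intros)
  then have "((\<lambda>t. ?s t) has_derivative (\<lambda>v. (\<lambda>v. ((\<Sum>i\<in>UNIV. of_int (lam i) * dilate lam (?s t) (snd (c0 - t * a, x)) $ i
       * dilate lam (?s t) (snd v) $ i) - fst v) * inverse (generator_sqnorm lam (dilate lam (?s t) (snd (c0 - t * a, x))))) (- (v * a), 0))) (at t)"
    by (rule has_derivative_compose) (rule has_derivative_level_time[OF lam r])
  then have s: "(?s has_derivative (\<lambda>v. v * (a / generator_sqnorm lam (y t)))) (at t)"
    by (rule has_derivative_eq_rhs) (simp add: fun_eq_iff y_def divide_inverse dilate_def mult_ac)
  have e: "((\<lambda>t. exp (- of_int (lam j) * ?s t)) has_derivative
      (\<lambda>v. exp (- of_int (lam j) * ?s t) * (- of_int (lam j) * (v * (a / generator_sqnorm lam (y t)))))) (at t)" for j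
    by (rule has_derivative_eq_rhs, rule has_derivative_exp, rule has_derivative_mult_right, rule s)
      (simp add: mult_ac)
  have "((\<lambda>t. \<chi> j. exp (- of_int (lam j) * ?s t) * x $ j) has_derivative
      (\<lambda>v. \<chi> j. (exp (- of_int (lam j) * ?s t) * (- of_int (lam j) * (v * (a / generator_sqnorm lam (y t))))) * x $ j)) (at t)"
    by (intro has_derivative_vec_lambda has_derivative_mult_left e)
  then show ?thesis
    unfolding has_vector_derivative_def y_def[abs_def] dilate_def[abs_def]
    by (rule has_derivative_eq_rhs) (simp add: fun_eq_iff vec_eq_iff)
qed

lemma integral_curve_flow:
  fixes x :: "real^'n"
  assumes lam: "\<forall>i. lam i \<noteq> 0" and r: "\<And>t. t \<in> J \<Longrightarrow> (c0 - t * a_H lam, x) \<in> reachable lam"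
  shows "integral_curve_on J punctured_real_space (chi_vf lam)
     (\<lambda>t. cvec (orbit_point lam (c0 - t * a_H lam) x))"
  unfolding integral_curve_on_def
proof (intro ballI conjI)
  fix t assume t: "t \<in> J"
  let ?y = "\<lambda>t. orbit_point lam (c0 - t * a_H lam) x"
  have nz: "?y t \<noteq> 0"
    using r[OF t] by (simp add: reachable_def)
  then show "cvec (?y t) \<in> punctured_real_space"
    by (rule cvec_in_punctured_real_space)
  show "((\<lambda>t. cvec (?y t)) has_vector_derivative chi_vf lam (cvec (?y t))) (at t within J)"
    unfolding chi_vf_cvec[OF lam nz]
    by (rule has_vector_derivative_at_within, rule bounded_linear.has_vector_derivative[OF bounded_linear_cvec])
      (rule has_vector_derivative_flow[OF lam r[OF t]])
qed

text \<open>Along an integral curve the coordinates satisfy \<open>y\<^sub>j' = -f \<lambda>\<^sub>j y\<^sub>j\<close> with a factor \<open>f\<close> common to all of them, so integrating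
factors built from the integral \<open>\<tau>\<close> of \<open>f\<close> show that the curve stays on the orbit of its initial point and has orbit
parameter \<open>\<tau>\<close>. The height changes at the constant rate \<open>-a\<close>, and this determines \<open>\<tau>\<close>.\<close>

lemma integral_curve_unique:
  fixes x :: "real^'n"
  assumes lam: "\<forall>i. lam i \<noteq> 0"
    and curve: "integral_curve_on J punctured_real_space (chi_vf lam) \<gamma>"
    and J: "{0..t} \<subseteq> J" and t: "0 \<le> t"
    and init: "\<gamma> 0 = cvec x"
  shows "\<gamma> t = cvec (orbit_point lam (height lam x - t * a_H lam) x)"
proof -
  let ?I = "{0..t}" and ?a = "a_H lam"
  define y where "y = (\<lambda>s. re_vec (\<gamma> s))"
  have \<gamma>: "\<gamma> s = cvec (y s)" "y s \<noteq> 0" if "s \<in> ?I" for s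
    using curve J that unfolding integral_curve_on_def y_def by (auto simp: punctured_real_space_iff)
  have y0: "y 0 = x"
    by (simp add: y_def init)
  define f where "f = (\<lambda>s. ?a / generator_sqnorm lam (y s))"
  have dy: "(y has_vector_derivative (- f s) *\<^sub>R (\<chi> j. of_int (lam j) * y s $ j)) (at s within ?I)" if s: "s \<in> ?I" for s
  proof -
    have "(\<gamma> has_vector_derivative chi_vf lam (\<gamma> s)) (at s within ?I)"
      using curve J s unfolding integral_curve_on_def by (blast intro: has_vector_derivative_within_subset)
    then have "(\<gamma> has_vector_derivative cvec ((- f s) *\<^sub>R (\<chi> j. of_int (lam j) * y s $ j))) (at s within ?I)"
      unfolding \<gamma>(1)[OF s] chi_vf_cvec[OF lam \<gamma>(2)[OF s]] f_def by simp
    from bounded_linear.has_vector_derivative[OF bounded_linear_re_vec this]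
    show ?thesis
      unfolding y_def[symmetric] by simp
  qed
  have dyj: "((\<lambda>s. y s $ j) has_real_derivative - f s * (of_int (lam j) * y s $ j)) (at s within ?I)" if s: "s \<in> ?I" for s j
    using bounded_linear.has_vector_derivative[OF bounded_linear_vec_nth[of j] dy[OF s]]
    by (simp add: has_real_derivative_iff_has_vector_derivative)
  have conty: "continuous_on ?I (\<lambda>s. y s $ j)" for j
    by (rule DERIV_continuous_on) (rule dyj)
  have nz: "generator_sqnorm lam (y s) \<noteq> 0" if "s \<in> ?I" for s
    using generator_sqnorm_pos[OF lam \<gamma>(2)[OF that]] by simp
  have contf: "continuous_on ?I f"
    unfolding f_def using nz unfolding generator_sqnorm_def by (intro continuous_intros conty) auto
  define \<tau> where "\<tau> = (\<lambda>s. integral {0..s} f)"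
  have d\<tau>: "(\<tau> has_real_derivative f s) (at s within ?I)" if "s \<in> ?I" for s
    unfolding \<tau>_def using contf that by (rule integral_has_real_derivative)
  have zero_const: "g t = g 0" if "\<And>s. s \<in> ?I \<Longrightarrow> (g has_real_derivative 0) (at s within ?I)" for g :: "real \<Rightarrow> real"
  proof -
    have "\<exists>c. \<forall>s\<in>?I. g s = c"
      using that by (intro has_derivative_zero_constant) (auto simp: has_field_derivative_def lambda_zero)
    then show ?thesis using t by auto
  qed
  have "y t $ j * exp (of_int (lam j) * \<tau> t) = y 0 $ j * exp (of_int (lam j) * \<tau> 0)" for j
    by (rule zero_const) (auto intro!: derivative_eq_intros dyj d\<tau> simp: algebra_simps)
  moreover have "\<tau> 0 = 0"
    by (simp add: \<tau>_def)
  ultimately have eq: "y t $ j * exp (of_int (lam j) * \<tau> t) = x $ j" for j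
    by (simp add: y0)
  have yt: "y t = dilate lam (\<tau> t) x"
    by (simp add: dilate_def vec_eq_iff exp_minus eq[symmetric])
  have "height lam (y t) + t * ?a = height lam (y 0) + 0 * ?a"
  proof (rule zero_const[of "\<lambda>s. height lam (y s) + s * ?a"])
    fix s assume s: "s \<in> ?I"
    have "((\<lambda>s. height lam (y s) + s * ?a) has_real_derivative
        (1/2) * (\<Sum>j\<in>UNIV. of_int (lam j) * (2 * (- f s * (of_int (lam j) * y s $ j)) * y s $ j)) + ?a) (at s within ?I)"
      unfolding height_def by (auto intro!: derivative_eq_intros dyj s simp: mult_ac)
    moreover have "(1/2) * (\<Sum>j\<in>UNIV. of_int (lam j) * (2 * (- f s * (of_int (lam j) * y s $ j)) * y s $ j)) = - f s * generator_sqnorm lam (y s)"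
      unfolding generator_sqnorm_def sum_distrib_left by (intro sum.cong refl) (simp add: power2_eq_square)
    ultimately show "((\<lambda>s. height lam (y s) + s * ?a) has_real_derivative 0) (at s within ?I)"
      using nz[OF s] by (simp add: f_def)
  qed
  then have "height lam (dilate lam (\<tau> t) x) = height lam x - t * ?a"
    unfolding yt y0 by simp
  moreover have "x \<noteq> 0"
    using \<gamma>(2)[of 0] t y0 by simp
  ultimately have "level_time lam (height lam x - t * ?a, x) = \<tau> t"
    by (intro level_time_eqI[OF lam])
  then show ?thesis
    using \<gamma>(1)[of t] t yt by simp
qed

section \<open>Charts of the product of a level set and the circle\<close>

lemma level_times_circle_iff:
  "(z, h) \<in> ({z. moment_map lam z = c} \<inter> punctured_real_space) \<times> sphere (0::complex) 1 \<longleftrightarrow>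
     z = cvec (re_vec z) \<and> re_vec z \<noteq> 0 \<and> height lam (re_vec z) = c \<and> cmod h = 1"
  using moment_map_cvec[of lam "re_vec z"] by (auto simp: punctured_real_space_iff)

text \<open>At a point whose \<open>k\<close>-th real coordinate is nonzero, the level equation can be solved for that coordinate by a square root. The
\<open>k\<close>-th parameter is thus free, and it serves as the sine of the angle from \<open>h0\<close> on the circle. In this way the inverse of the
chart is the restriction of a linear map.\<close>

lemma smooth_submanifold_level_times_circle:
  fixes lam :: "'n::finite \<Rightarrow> int"
  assumes lam: "\<forall>i. lam i \<noteq> 0"
  shows "smooth_submanifold TYPE('n) (({z. moment_map lam z = c} \<inter> punctured_real_space) \<times> sphere (0::complex) 1)"
    (is "smooth_submanifold _ ?N")
  unfolding smooth_submanifold_def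
proof
  fix q assume "q \<in> ?N"
  moreover obtain p h0 where q: "q = (p, h0)" by (cases q)
  ultimately have p: "p = cvec (re_vec p)" "re_vec p \<noteq> 0" "height lam (re_vec p) = c" and h0: "cmod h0 = 1"
    using level_times_circle_iff by blast+
  obtain k where k: "re_vec p $ k \<noteq> 0"
    using p(2) by (auto simp: vec_eq_iff)
  have lk: "of_int (lam k) \<noteq> (0::real)"
    using lam by simp
  have hh: "h0 * cnj h0 = 1"
    using h0 by (simp add: complex_norm_square[symmetric])
  \<comment> \<open>The branch of the square root that passes through \<open>p\<close>.\<close>
  define e where "e = sgn (re_vec p $ k)"
  have e: "e * e = 1" "e \<noteq> 0"
    using k by (auto simp: e_def sgn_if)
  define rad :: "real^'n \<Rightarrow> real" where
    "rad u = (2 * c + (\<Sum>j\<in>-{k}. - of_int (lam j) * (u $ j)\<^sup>2)) * (1 / of_int (lam k))" for u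
  define U where "U = {u. 0 < rad u \<and> 0 < 1 + - 1 * (u $ k)\<^sup>2}"
  define x :: "real^'n \<Rightarrow> real^'n" where "x u = (\<chi> j. if j = k then e * sqrt (rad u) else u $ j)" for u
  define w :: "real^'n \<Rightarrow> complex" where "w u = of_real (sqrt (1 + - 1 * (u $ k)\<^sup>2)) + \<i> * of_real (u $ k)" for u
  define \<phi> where "\<phi> = (\<lambda>u. (cvec (x u), h0 * w u))"
  define \<psi> :: "(complex^'n) \<times> complex \<Rightarrow> real^'n" where
    "\<psi> = (\<lambda>q. \<chi> j. if j = k then Im (snd q * cnj h0) else Re (fst q $ j))"
  define V where "V = {q :: (complex^'n) \<times> complex. 0 < e * Re (fst q $ k) \<and> 0 < Re (snd q * cnj h0)}"
  have rad: "2 * height lam y = of_int (lam k) * ((y $ k)\<^sup>2 - rad y) + 2 * c" for y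
  proof -
    have "2 * height lam y = of_int (lam k) * (y $ k)\<^sup>2 + (\<Sum>j\<in>-{k}. of_int (lam j) * (y $ j)\<^sup>2)"
      by (simp add: height_def sum.remove[of UNIV k] Compl_eq_Diff_UNIV)
    then show ?thesis
      using lk by (simp add: rad_def sum_negf field_simps)
  qed
  have rad_x: "rad (x u) = rad u" for u
    by (simp add: rad_def x_def cong: sum.cong_simp)
  \<comment> \<open>The square root solves the level equation, since \<open>rad\<close> ignores the \<open>k\<close>-th coordinate.\<close>
  have x_height: "height lam (x u) = c" if "u \<in> U" for u
  proof -
    have "(x u $ k)\<^sup>2 = (e * e) * (sqrt (rad u))\<^sup>2"
      by (simp add: x_def power2_eq_square)
    also have "\<dots> = rad u"
      using that e by (simp add: U_def)
    finally show ?thesis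
      using rad[of "x u"] by (simp add: rad_x)
  qed
  have x_nz: "x u \<noteq> 0" if "u \<in> U" for u
    using that e(2) by (auto simp: U_def x_def vec_eq_iff intro!: exI[of _ k])
  have cmod_w: "cmod (w u) = 1" if "u \<in> U" for u
    using that by (simp add: w_def cmod_def U_def)
  have cancel: "h0 * a * cnj h0 = a" for a
    using hh by (metis mult.commute mult.left_commute mult.right_neutral)
  have \<psi>\<phi>: "\<psi> (\<phi> u) = u" if "u \<in> U" for u
    unfolding \<psi>_def \<phi>_def fst_conv snd_conv cancel by (simp add: w_def cvec_def x_def vec_eq_iff)
  have openU: "open U"
    unfolding U_def rad_def by (intro open_Collect_conj open_Collect_less continuous_intros)
  have openV: "open V"
    unfolding V_def by (intro open_Collect_conj open_Collect_less continuous_intros)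
  have image: "\<phi> ` U = ?N \<inter> V"
  proof (intro subset_antisym subsetI)
    fix q assume "q \<in> \<phi> ` U"
    then obtain u where u: "u \<in> U" "q = \<phi> u" by blast
    have "\<phi> u \<in> ?N"
      unfolding \<phi>_def level_times_circle_iff
      using x_height[OF u(1)] x_nz[OF u(1)] cmod_w[OF u(1)] h0 by (simp add: norm_mult)
    moreover have "\<phi> u \<in> V"
      unfolding \<phi>_def V_def mem_Collect_eq fst_conv snd_conv cancel
      using u(1) e by (simp add: cvec_def x_def w_def U_def mult.assoc[symmetric])
    ultimately show "q \<in> ?N \<inter> V"
      using u(2) by simp
  next
    fix q assume q: "q \<in> ?N \<inter> V"
    obtain z h where zh: "q = (z, h)" by (cases q)
    define y where "y = re_vec z"
    have z: "z = cvec y" "height lam y = c" and h: "cmod h = 1"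
      using q level_times_circle_iff unfolding zh y_def by blast+
    have V: "0 < e * y $ k" "0 < Re (h * cnj h0)"
      using q by (auto simp: zh V_def y_def re_vec_def)
    define u where "u = \<psi> q"
    have rad_u: "rad u = (y $ k)\<^sup>2"
    proof -
      have "rad u = rad y"
        by (simp add: rad_def u_def \<psi>_def zh z cvec_def cong: sum.cong_simp)
      then show ?thesis
        using rad[of y] lk z(2) by simp
    qed
    have "e * \<bar>y $ k\<bar> = y $ k"
      using V(1) by (auto simp: e_def sgn_if abs_if zero_less_mult_iff split: if_splits)
    then have xu: "x u = y"
      by (simp add: x_def rad_u vec_eq_iff) (simp add: u_def \<psi>_def zh z cvec_def)
    have uk: "u $ k = Im (h * cnj h0)"
      by (simp add: u_def \<psi>_def zh)
    have "cmod (h * cnj h0) = 1"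
      using h h0 by (simp add: norm_mult)
    then have "(Re (h * cnj h0))\<^sup>2 + (Im (h * cnj h0))\<^sup>2 = 1"
      by (metis cmod_power2 power_one)
    then have Re: "1 + - 1 * (u $ k)\<^sup>2 = (Re (h * cnj h0))\<^sup>2"
      unfolding uk by linarith
    then have wu: "w u = h * cnj h0"
      using V(2) unfolding w_def Re by (simp add: uk complex_eq_iff del: times_complex.sel)
    have "u \<in> U"
      unfolding U_def mem_Collect_eq rad_u Re using V by (auto simp: zero_less_mult_iff)
    moreover have "\<phi> u = q"
      using hh unfolding \<phi>_def xu wu zh z(1)[symmetric] by (simp add: mult.left_commute)
    ultimately show "q \<in> \<phi> ` U" by blast
  qed
  have smooth\<phi>: "Ck_on m U \<phi>" for m
  proof -
    have nth: "Ck_on m U (\<lambda>u. u $ j)" for j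
      by (rule Ck_on_linear[OF bounded_linear_vec_nth])
    have "Ck_on m U rad"
      unfolding rad_def[abs_def]
      by (intro Ck_on_mult Ck_on_add Ck_on_sum Ck_on_power Ck_on_const openU nth)
    then have s1: "Ck_on m U (\<lambda>u. sqrt (rad u))"
      by (rule Ck_on_compose[OF openU Ck_on_sqrt]) (simp add: U_def)
    have "Ck_on m U (\<lambda>u. 1 + - 1 * (u $ k)\<^sup>2)"
      by (intro Ck_on_mult Ck_on_add Ck_on_power Ck_on_const openU nth)
    then have s2: "Ck_on m U (\<lambda>u. sqrt (1 + - 1 * (u $ k)\<^sup>2))"
      by (rule Ck_on_compose[OF openU Ck_on_sqrt]) (simp add: U_def)
    have "Ck_on m U x"
      unfolding x_def[abs_def]
    proof (rule Ck_on_vec_lambda[OF openU])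
      fix j
      show "Ck_on m U (\<lambda>u. if j = k then e * sqrt (rad u) else u $ j)"
        by (cases "j = k") (simp_all add: nth Ck_on_mult[OF openU Ck_on_const s1])
    qed
    then have 1: "Ck_on m U (\<lambda>u. cvec (x u))"
      by (rule Ck_on_linear_compose[OF bounded_linear_cvec openU])
    have 2: "Ck_on m U (\<lambda>u. h0 * w u)"
      unfolding w_def
      by (intro Ck_on_mult[OF openU] Ck_on_add[OF openU] Ck_on_const
          Ck_on_linear_compose[OF bounded_linear_of_real openU] nth s2)
    show ?thesis
      unfolding \<phi>_def by (rule Ck_on_Pair[OF openU 1 2])
  qed
  have "bounded_linear \<psi>"
    unfolding \<psi>_def
    by (intro linear_conv_bounded_linear[THEN iffD1] linearI) (auto simp: vec_eq_iff algebra_simps)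
  then have "smooth_map_on (\<phi> ` U) \<psi>"
    by (intro smooth_map_onI[of UNIV _ \<psi>] Ck_on_linear) auto
  moreover have "smooth_map_on U \<phi>"
    using smooth\<phi> by (intro smooth_map_onI[of U _ \<phi>] openU) auto
  ultimately have "local_param ?N U \<phi>"
    unfolding local_param_def using openU \<psi>\<phi> openV image by (auto simp: openin_open_Int)
  moreover have "q \<in> V"
    unfolding V_def q mem_Collect_eq fst_conv snd_conv hh using k
    by (auto simp: e_def re_vec_def sgn_if zero_less_mult_iff)
  then have "q \<in> \<phi> ` U"
    unfolding image using \<open>q \<in> ?N\<close> by blast
  ultimately show "\<exists>U (\<phi> :: real^'n \<Rightarrow> _). local_param ?N U \<phi> \<and> q \<in> \<phi> ` U"
    by blast
qed

text \<open>Differentiating the identity \<open>\<psi> (\<phi> u) = u\<close> for a smooth extension of the inverse \<open>\<psi>\<close>.\<close>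

lemma local_param_derivative_inj:
  assumes "local_param N U \<phi>" "u \<in> U" "(\<phi> has_derivative D) (at u)" "D v = 0"
  shows "v = 0"
proof -
  obtain \<psi> where \<psi>: "smooth_map_on (\<phi> ` U) \<psi>" "\<And>u. u \<in> U \<Longrightarrow> \<psi> (\<phi> u) = u" and U: "open U"
    using assms(1) unfolding local_param_def by blast
  then obtain W g where W: "open W" "\<phi> u \<in> W" "\<And>k. Ck_on k W g" "\<And>q. q \<in> W \<inter> \<phi> ` U \<Longrightarrow> g q = \<psi> q"
    using assms(2) unfolding smooth_map_on_def by (metis imageI)
  have "(g has_derivative frechet_derivative g (at (\<phi> u))) (at (\<phi> u))"
    by (rule Ck_on_has_derivative[OF W(3) W(2)])
  from has_derivative_compose[OF assms(3) this]
  have "((\<lambda>u. g (\<phi> u)) has_derivative (\<lambda>v. frechet_derivative g (at (\<phi> u)) (D v))) (at u)" .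
  moreover have "((\<lambda>u. g (\<phi> u)) has_derivative (\<lambda>v. v)) (at u)"
  proof -
    have "continuous_on U \<phi>"
      using assms(1) U smooth_map_on_open_imp_Ck_on[of U \<phi> 0] by (simp add: local_param_def)
    then have "open (U \<inter> \<phi> -` W)"
      using U W(1) by (simp add: continuous_on_open_vimage Int_commute)
    then show ?thesis
      by (rule has_derivative_transform_within_open[OF has_derivative_ident]) (use assms(2) W \<psi>(2) in auto)
  qed
  ultimately have "(\<lambda>v. frechet_derivative g (at (\<phi> u)) (D v)) = (\<lambda>v. v)"
    by (rule has_derivative_unique)
  then have "v = frechet_derivative g (at (\<phi> u)) 0"
    using assms(4) by (metis)
  also have "\<dots> = 0"
    using has_derivative_linear[OF Ck_on_has_derivative[OF W(3) W(2)]] by (rule linear_0)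
  finally show ?thesis .
qed

section \<open>Geometry of the maps at a fixed time\<close>

text \<open>If the moved point is stationary to first order, then \<open>x\<close> can only move along its orbit, in the direction \<open>\<Lambda>x\<close>.
That direction is transverse to the level set to which \<open>x\<close> is tangent.\<close>

lemma orbit_point_immersive:
  fixes x :: "'a::real_normed_vector \<Rightarrow> real^'n"
  assumes lam: "\<forall>i. lam i \<noteq> 0"
    and x: "(x has_derivative x') (at u)"
    and r: "(c, x u) \<in> reachable lam"
    and tangent: "x' v \<bullet> (\<chi> j. of_int (lam j) * x u $ j) = 0"
    and y: "((\<lambda>u. orbit_point lam c (x u)) has_derivative y') (at u)"
    and "y' v = 0"
  shows "x' v = 0"
proof -
  let ?s = "\<lambda>u. level_time lam (c, x u)" and ?y = "\<lambda>u. orbit_point lam c (x u)"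
  have "((\<lambda>u. (c, x u)) has_derivative (\<lambda>v. (0, x' v))) (at u)"
    by (intro has_derivative_Pair has_derivative_const x)
  from has_derivative_compose[OF this has_derivative_level_time[OF lam r]]
  obtain s' where s: "(?s has_derivative s') (at u)"
    by blast
  have e: "((\<lambda>u. exp (of_int (lam j) * ?s u)) has_derivative
      (\<lambda>v. exp (of_int (lam j) * ?s u) * (of_int (lam j) * s' v))) (at u)" for j
    by (rule has_derivative_eq_rhs, rule has_derivative_exp, rule has_derivative_mult_right, rule s)
      (simp add: mult_ac)
  have x': "x' v $ j = s' v * (of_int (lam j) * x u $ j)" for j
  proof -
    have orbit: "exp (of_int (lam j) * ?s u) * ?y u $ j = x u $ j" for u
      by (simp add: dilate_def exp_minus)
    have "((\<lambda>u. exp (of_int (lam j) * ?s u) * ?y u $ j) has_derivative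
      (\<lambda>v. exp (of_int (lam j) * ?s u) * y' v $ j + exp (of_int (lam j) * ?s u) * (of_int (lam j) * s' v) * ?y u $ j)) (at u)"
      by (intro has_derivative_mult e has_derivative_nth y)
    then have "(\<lambda>v. exp (of_int (lam j) * ?s u) * y' v $ j + exp (of_int (lam j) * ?s u) * (of_int (lam j) * s' v) * ?y u $ j)
        = (\<lambda>v. x' v $ j)"
      unfolding orbit using has_derivative_nth[OF x] by (rule has_derivative_unique)
    then have "x' v $ j = exp (of_int (lam j) * ?s u) * y' v $ j + exp (of_int (lam j) * ?s u) * (of_int (lam j) * s' v) * ?y u $ j"
      by metis
    also have "\<dots> = s' v * (of_int (lam j) * (exp (of_int (lam j) * ?s u) * ?y u $ j))"
      using \<open>y' v = 0\<close> by simp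
    finally show ?thesis
      unfolding orbit .
  qed
  have "x' v \<bullet> (\<chi> j. of_int (lam j) * x u $ j) = s' v * generator_sqnorm lam (x u)"
    by (simp add: inner_vec_def x' generator_sqnorm_def sum_distrib_left power2_eq_square mult.assoc)
  moreover have "generator_sqnorm lam (x u) > 0"
    using r by (intro generator_sqnorm_pos[OF lam]) (simp add: reachable_def)
  ultimately have "s' v = 0"
    using tangent by simp
  then show ?thesis
    using x' by (simp add: vec_eq_iff)
qed

text \<open>Read in an arbitrary parametrization \<open>\<phi>\<close>, the map at a fixed time is a \<open>circle_sweep\<close> whose real part is the initial point
moved along its orbit to the level \<open>c\<close>.\<close>

lemma orbit_circle_sweep:
  fixes lam :: "'n::finite \<Rightarrow> int" and \<phi> :: "real^'n \<Rightarrow> (complex^'n) \<times> complex"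
  defines "x \<equiv> \<lambda>u. re_vec (fst (\<phi> u))" and "h \<equiv> \<lambda>u. snd (\<phi> u)"
  assumes lam: "\<forall>i. lam i \<noteq> 0"
    and param: "local_param (({z. moment_map lam z = c0} \<inter> punctured_real_space) \<times> sphere 0 1) U \<phi>"
    and reachable: "\<And>x. x \<noteq> 0 \<Longrightarrow> height lam x = c0 \<Longrightarrow> (c, x) \<in> reachable lam"
    and f: "\<And>u. u \<in> U \<Longrightarrow> f u = act lam (cvec (orbit_point lam c (x u))) (h u)"
  shows "circle_sweep lam U (\<lambda>u. orbit_point lam c (x u)) h (2 * c) f"
    and "\<And>u. u \<in> U \<Longrightarrow> fst (\<phi> u) = cvec (x u) \<and> x u \<noteq> 0 \<and> height lam (x u) = c0 \<and> cmod (h u) = 1"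
    and "Ck_on k U x"
proof -
  have U: "open U" and \<phi>: "Ck_on k U \<phi>" for k
    using param smooth_map_on_open_imp_Ck_on by (auto simp: local_param_def)
  have "\<phi> u \<in> ({z. moment_map lam z = c0} \<inter> punctured_real_space) \<times> sphere 0 1" if "u \<in> U" for u
    using param that openin_imp_subset unfolding local_param_def by blast
  then show N: "fst (\<phi> u) = cvec (x u) \<and> x u \<noteq> 0 \<and> height lam (x u) = c0 \<and> cmod (h u) = 1" if "u \<in> U" for u
    using that level_times_circle_iff[of "fst (\<phi> u)" "snd (\<phi> u)" lam c0] unfolding x_def h_def by simp
  have fst: "Ck_on k U (\<lambda>u. fst (\<phi> u))" and h: "Ck_on k U h" for k
    unfolding h_def
    by (rule Ck_on_linear_compose[OF bounded_linear_fst U \<phi>] Ck_on_linear_compose[OF bounded_linear_snd U \<phi>])+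
  show x: "Ck_on k U x" for k
    unfolding x_def by (rule Ck_on_linear_compose[OF bounded_linear_re_vec U fst])
  have r: "(c, x u) \<in> reachable lam" if "u \<in> U" for u
    using N[OF that] reachable by blast
  have "Ck_on k U (\<lambda>u. level_time lam (c, x u))" for k
    by (rule Ck_on_compose[OF U Ck_on_level_time[OF lam] Ck_on_Pair[OF U Ck_on_const x] r])
  then have "Ck_on 2 U (\<lambda>u. orbit_point lam c (x u))"
    by (intro Ck_on_dilate[OF U] x)
  moreover have "(\<Sum>j\<in>UNIV. of_int (lam j) * (orbit_point lam c (x u) $ j)\<^sup>2) = 2 * c" if "u \<in> U" for u
    using height_dilate_level_time[OF lam r[OF that]] by (simp add: height_def)
  ultimately show "circle_sweep lam U (\<lambda>u. orbit_point lam c (x u)) h (2 * c) f"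
    using U h N f by unfold_locales auto
qed

lemma orbit_sweep_geometry:
  fixes lam :: "'n::finite \<Rightarrow> int" and \<phi> :: "real^'n \<Rightarrow> (complex^'n) \<times> complex"
  defines "x \<equiv> \<lambda>u. re_vec (fst (\<phi> u))" and "h \<equiv> \<lambda>u. snd (\<phi> u)"
  assumes lam: "\<forall>i. lam i \<noteq> 0"
    and param: "local_param (({z. moment_map lam z = c0} \<inter> punctured_real_space) \<times> sphere 0 1) U \<phi>"
    and reachable: "\<And>x. x \<noteq> 0 \<Longrightarrow> height lam x = c0 \<Longrightarrow> (c, x) \<in> reachable lam"
    and f: "\<And>u. u \<in> U \<Longrightarrow> f u = act lam (cvec (orbit_point lam c (x u))) (h u)"
    and u: "u \<in> U"
  shows "inj (frechet_derivative f (at u))"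
    and "kaehler_form (frechet_derivative f (at u) v) (frechet_derivative f (at u) w) = 0"
    and "mean_curvature_vector f u = act lam (chi_vf lam (cvec (orbit_point lam c (x u)))) (h u)"
proof -
  let ?y = "\<lambda>u. orbit_point lam c (x u)"
  have f': "f u = act lam (cvec (orbit_point lam c (re_vec (fst (\<phi> u))))) (snd (\<phi> u))" if "u \<in> U" for u
    using f[OF that] by (simp only: x_def h_def)
  interpret T: circle_sweep lam U ?y h "2 * c" f
    unfolding x_def h_def by (rule orbit_circle_sweep(1)[OF lam param reachable f'])
  have N: "fst (\<phi> u) = cvec (x u) \<and> x u \<noteq> 0 \<and> height lam (x u) = c0 \<and> cmod (h u) = 1" if "u \<in> U" for u
    unfolding x_def h_def by (rule orbit_circle_sweep(2)[OF lam param reachable f' that])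
  have x: "Ck_on k U x" for k
    unfolding x_def by (rule orbit_circle_sweep(3)[OF lam param reachable f'])
  \<comment> \<open>The initial parametrization is a \<open>circle_sweep\<close> too, which makes the derivative of \<open>x\<close> tangent to its level.\<close>
  interpret T0: circle_sweep lam U x h "2 * c0" "\<lambda>u. act lam (cvec (x u)) (h u)"
    using T.open_U T.h_C2 x N by unfold_locales (auto simp: height_def)
  have r: "(c, x u) \<in> reachable lam"
    using N[OF u] reachable by blast
  have y_nz: "?y u \<noteq> 0"
    using N[OF u] by simp
  have generator_sqnorm: "T.nu u \<bullet> T.nu u = generator_sqnorm lam (?y u)"
    by (simp add: T.nu_def generator_sqnorm_eq_inner)
  have nz: "T.nu u \<noteq> 0"
    using generator_sqnorm_pos[OF lam y_nz] generator_sqnorm by auto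
  have immersive: "v = 0" if "T.dy u v = 0" "T.dth u v = 0" for v
  proof -
    have dx: "T0.dy u v = 0"
    proof (rule orbit_point_immersive[OF lam T0.y_deriv[OF u] r _ T.y_deriv[OF u] that(1)])
      show "T0.dy u v \<bullet> (\<chi> j. of_int (lam j) * x u $ j) = 0"
        using T0.dy_orthogonal_nu[OF u] by (simp add: T0.nu_def)
    qed
    have dh: "frechet_derivative h (at u) v = 0"
      using has_derivative_unit_circle[OF T.open_U u T.unit T.h_deriv[OF u], of v]
      unfolding T.dth_def[symmetric] that(2) by simp
    have "(\<phi> has_derivative (\<lambda>v. (cvec (T0.dy u v), frechet_derivative h (at u) v))) (at u)"
    proof (rule has_derivative_transform_within_open[OF _ T.open_U u])
      show "((\<lambda>u. (cvec (x u), h u)) has_derivative (\<lambda>v. (cvec (T0.dy u v), frechet_derivative h (at u) v))) (at u)"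
        by (intro has_derivative_Pair bounded_linear.has_derivative[OF bounded_linear_cvec] T0.y_deriv T.h_deriv u)
      show "(cvec (x u), h u) = \<phi> u" if "u \<in> U" for u
        using N[OF that] by (simp add: h_def prod_eq_iff)
    qed
    then show "v = 0"
      by (rule local_param_derivative_inj[OF param u]) (simp add: dx dh cvec_def vec_eq_iff prod_eq_iff)
  qed
  show "inj (frechet_derivative f (at u))"
    using u nz immersive by (rule T.inj_frechet_f)
  show "kaehler_form (frechet_derivative f (at u) v) (frechet_derivative f (at u) w) = 0"
    using u by (rule T.kaehler_form_f)
  have "mean_curvature_vector f u =
      act lam (cvec ((- (\<Sum>j\<in>UNIV. of_int (lam j)) / (T.nu u \<bullet> T.nu u)) *\<^sub>R T.nu u)) (h u)"
    using u nz immersive by (rule T.mean_curvature_vector_f)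
  then show "mean_curvature_vector f u = act lam (chi_vf lam (cvec (?y u))) (h u)"
    unfolding generator_sqnorm chi_vf_cvec[OF lam y_nz] by (simp add: T.nu_def a_H_def)
qed

section \<open>Smoothness of the family\<close>

text \<open>A polynomial in \<open>h\<close> and \<open>cnj h\<close> that agrees with the integer power on the unit circle, hence an extension of it that is
smooth on the whole plane.\<close>

definition circle_pow :: "int \<Rightarrow> complex \<Rightarrow> complex" where
  "circle_pow l h = (if l \<ge> 0 then h ^ nat l else cnj h ^ nat (- l))"

lemma circle_pow_eq:
  assumes "cmod h = 1"
  shows "circle_pow l h = h powi l"
proof -
  have "cnj h = inverse h"
    using assms by (intro inverse_unique[symmetric]) (simp add: complex_norm_square[symmetric])
  then show ?thesis
    by (simp add: circle_pow_def power_int_def)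
qed

lemma Ck_on_circle_pow:
  assumes "open S" "Ck_on k S f"
  shows "Ck_on k S (\<lambda>q. circle_pow l (f q))"
  using assms unfolding circle_pow_def
  by (cases "l \<ge> 0") (simp_all add: Ck_on_power Ck_on_linear_compose[OF bounded_linear_cnj])

text \<open>Extends \<open>(t, p, h) \<mapsto> F\<^sub>t(p, h)\<close> to the ambient space; the extension is smooth on the open set \<open>orbit_dom\<close>.\<close>

definition orbit_ext :: "('n::finite \<Rightarrow> int) \<Rightarrow> real \<Rightarrow> real \<times> (complex^'n) \<times> complex \<Rightarrow> complex^'n" where
  "orbit_ext lam c0 q = (\<chi> j. cvec (orbit_point lam (c0 - fst q * a_H lam) (re_vec (fst (snd q)))) $ j
      * circle_pow (lam j) (snd (snd q)))"

definition orbit_dom :: "('n::finite \<Rightarrow> int) \<Rightarrow> real \<Rightarrow> (real \<times> (complex^'n) \<times> complex) set" where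
  "orbit_dom lam c0 = (\<lambda>q. (c0 + fst q * - a_H lam, re_vec (fst (snd q)))) -` reachable lam"

lemma orbit_ext_eq:
  "cmod h = 1 \<Longrightarrow> orbit_ext lam c0 (t, z, h) = act lam (cvec (orbit_point lam (c0 - t * a_H lam) (re_vec z))) h"
  by (simp add: orbit_ext_def act_def circle_pow_eq)

lemma Ck_on_orbit_arg:
  "Ck_on k S (\<lambda>q :: real \<times> (complex^'n) \<times> complex. (c0 + fst q * - a, re_vec (fst (snd q))))"
proof -
  have "bounded_linear (\<lambda>q :: real \<times> (complex^'n) \<times> complex. re_vec (fst (snd q)))"
    by (intro bounded_linear_compose[OF bounded_linear_re_vec] bounded_linear_compose[OF bounded_linear_fst]
        bounded_linear_snd)
  then have "Ck_on k UNIV (\<lambda>q :: real \<times> (complex^'n) \<times> complex. (c0 + fst q * - a, re_vec (fst (snd q))))"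
    by (intro Ck_on_Pair Ck_on_add Ck_on_mult Ck_on_const Ck_on_linear bounded_linear_fst open_UNIV)
  then show ?thesis
    by (rule Ck_on_subset) simp
qed

lemma open_orbit_dom: "\<forall>i. lam i \<noteq> 0 \<Longrightarrow> open (orbit_dom lam c0)"
  unfolding orbit_dom_def using Ck_on_imp_continuous_on[OF Ck_on_orbit_arg[of 0 UNIV c0 "a_H lam"]]
  by (intro open_vimage open_reachable)

lemma Ck_on_orbit_ext:
  assumes lam: "\<forall>i. lam i \<noteq> 0"
  shows "Ck_on k (orbit_dom lam c0) (orbit_ext lam c0)"
proof -
  note o = open_orbit_dom[OF lam, of c0]
  have s: "Ck_on k (orbit_dom lam c0) (\<lambda>q. level_time lam (c0 + fst q * - a_H lam, re_vec (fst (snd q))))"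
    by (rule Ck_on_compose[OF o Ck_on_level_time[OF lam] Ck_on_orbit_arg]) (simp add: orbit_dom_def)
  have x: "Ck_on k (orbit_dom lam c0) (\<lambda>q. re_vec (fst (snd q)))"
    using Ck_on_linear_compose[OF bounded_linear_snd o Ck_on_orbit_arg[of k _ c0 "a_H lam"]] by simp
  have h: "Ck_on k (orbit_dom lam c0) (\<lambda>q. snd (snd q))"
    by (intro Ck_on_linear bounded_linear_compose[OF bounded_linear_snd] bounded_linear_snd)
  show ?thesis
    unfolding orbit_ext_def[abs_def]
    using Ck_on_linear_compose[OF bounded_linear_cvec o Ck_on_dilate[OF o s x, of lam]]
    by (intro Ck_on_vec_lambda[OF o] Ck_on_mult[OF o] Ck_on_circle_pow[OF o] h Ck_on_vec_nth[OF o]) simp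
qed

section \<open>The mean curvature flow\<close>

text \<open>A change of sign before time \<open>t\<close> would produce the zero \<open>c\<^sub>0 / a\<close> in the interval.\<close>

lemma same_sign_on_time_interval:
  fixes c0 a :: real
  assumes "c0 \<noteq> 0" "\<forall>t\<in>time_interval T. c0 - t * a \<noteq> 0" "t \<in> time_interval T"
  shows "0 < c0 * (c0 - t * a)"
proof (rule ccontr)
  assume "\<not> ?thesis"
  then have le: "c0 * c0 \<le> t * (a * c0)"
    by (simp add: algebra_simps)
  have t: "0 \<le> t" "ereal t < T"
    using assms(3) by (auto simp: time_interval_def)
  have pos: "0 < c0 * c0"
    using assms(1) by (simp add: not_square_less_zero less_le)
  then have "0 < t * (a * c0)"
    using le by linarith
  then have ac: "0 < a * c0"
    using t(1) by (auto simp: zero_less_mult_iff)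
  define s where "s = c0 * c0 / (a * c0)"
  have "0 \<le> s" "s \<le> t"
    using pos ac unfolding s_def by (auto intro: divide_nonneg_pos simp only: pos_divide_le_eq le)
  then have "s \<in> time_interval T"
    using t by (auto simp: time_interval_def intro: le_less_trans[of "ereal s" "ereal t"])
  moreover have "c0 - s * a = 0"
    using ac unfolding s_def by auto
  ultimately show False
    using assms(2) by blast
qed

theorem proposition3p2:
  fixes lam :: "'n::finite \<Rightarrow> int" and c0 :: real and T :: ereal
  defines "L \<equiv> (punctured_real_space :: (complex^'n) set)"
  defines "N0 \<equiv> {z. moment_map lam z = c0} \<inter> L"
  assumes "\<forall>i. lam i \<noteq> 0"
    and "c0 \<noteq> 0"
    and "0 < T"
    and "\<forall>t\<in>time_interval T. c0 - t * a_H lam \<noteq> 0"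
  shows "(\<forall>p\<in>N0. \<exists>c. c 0 = p \<and> integral_curve_on (time_interval T) L (chi_vf lam) c) \<and>
    (\<forall>\<gamma>. (\<forall>p\<in>N0. \<gamma> p 0 = p \<and> integral_curve_on (time_interval T) L (chi_vf lam) (\<gamma> p)) \<longrightarrow>
      lagrangian_mcf (time_interval T) (N0 \<times> sphere (0::complex) 1)
        (\<lambda>t (p, h). act lam (\<gamma> p t) h))"
proof -
  let ?J = "time_interval T" and ?S = "sphere (0::complex) 1"
  note lam = assms(3)
  have N0: "p = cvec (re_vec p) \<and> re_vec p \<noteq> 0 \<and> height lam (re_vec p) = c0" if "p \<in> N0" for p
    using that level_times_circle_iff[of p 1 lam c0] unfolding N0_def L_def by simp
  have reachable: "(c0 - t * a_H lam, x) \<in> reachable lam" if "t \<in> ?J" "x \<noteq> 0" "height lam x = c0" for t x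
    using same_sign_on_time_interval[OF assms(4,6) that(1)] that(2,3) height_dilate_attains[of lam x]
    by (auto simp: reachable_def)
  show ?thesis
  proof (intro conjI ballI allI impI)
    fix p assume p: "p \<in> N0"
    let ?c = "\<lambda>t. cvec (orbit_point lam (c0 - t * a_H lam) (re_vec p))"
    have "level_time lam (c0, re_vec p) = 0"
      using N0[OF p] by (intro level_time_eqI[OF lam]) auto
    then have "?c 0 = p"
      using N0[OF p] by simp
    moreover have "integral_curve_on ?J L (chi_vf lam) ?c"
      unfolding L_def using N0[OF p] by (intro integral_curve_flow[OF lam] reachable) auto
    ultimately show "\<exists>c. c 0 = p \<and> integral_curve_on ?J L (chi_vf lam) c"
      by (intro exI[of _ ?c] conjI)
  next
    fix \<gamma> assume \<gamma>: "\<forall>p\<in>N0. \<gamma> p 0 = p \<and> integral_curve_on ?J L (chi_vf lam) (\<gamma> p)"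
    let ?F = "\<lambda>t (p, h). act lam (\<gamma> p t) h"
    have flow: "\<gamma> p t = cvec (orbit_point lam (c0 - t * a_H lam) (re_vec p))" if "p \<in> N0" "t \<in> ?J" for p t
    proof -
      have "{0..t} \<subseteq> ?J" "0 \<le> t"
        using that(2) by (auto simp: time_interval_def intro: le_less_trans[of "ereal _" "ereal t"])
      moreover have "\<gamma> p 0 = cvec (re_vec p)"
        using \<gamma> N0 that(1) by metis
      ultimately show ?thesis
        using integral_curve_unique[OF lam, of ?J "\<gamma> p" t "re_vec p"] \<gamma> N0[OF that(1)] that(1)
        unfolding L_def by metis
    qed
    have ext: "(t, p, h) \<in> orbit_dom lam c0 \<and> orbit_ext lam c0 (t, p, h) = ?F t (p, h)"
      if "t \<in> ?J" "p \<in> N0" "h \<in> ?S" for t p h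
      using that N0[OF that(2)] reachable[OF that(1)] flow[OF that(2,1)]
      by (simp add: orbit_ext_eq orbit_dom_def)
    have sub: "smooth_submanifold TYPE('n) (N0 \<times> ?S)"
      unfolding N0_def L_def by (rule smooth_submanifold_level_times_circle[OF lam])
    have geom: "inj (frechet_derivative (?F t \<circ> \<phi>) (at u))"
        "kaehler_form (frechet_derivative (?F t \<circ> \<phi>) (at u) v) (frechet_derivative (?F t \<circ> \<phi>) (at u) w) = 0"
        "((\<lambda>s. ?F s (\<phi> u)) has_vector_derivative mean_curvature_vector (?F t \<circ> \<phi>) u) (at t within ?J)"
      if t: "t \<in> ?J" and param: "local_param (N0 \<times> ?S) U \<phi>" and u: "u \<in> U"
      for t U u v w and \<phi> :: "real^'n \<Rightarrow> (complex^'n) \<times> complex"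
    proof -
      have mem: "fst (\<phi> u) \<in> N0 \<and> snd (\<phi> u) \<in> ?S" if "u \<in> U" for u
        using param that openin_imp_subset unfolding local_param_def
        by (metis imageI mem_Times_iff subsetD)
      have f: "(?F t \<circ> \<phi>) u = act lam (cvec (orbit_point lam (c0 - t * a_H lam) (re_vec (fst (\<phi> u))))) (snd (\<phi> u))"
        if "u \<in> U" for u
        using flow[OF _ t, of "fst (\<phi> u)"] mem[OF that] by (simp add: case_prod_unfold)
      note G = orbit_sweep_geometry[OF lam param[unfolded N0_def L_def] reachable[OF t] f u]
      show "inj (frechet_derivative (?F t \<circ> \<phi>) (at u))"
        by (rule G(1))
      show "kaehler_form (frechet_derivative (?F t \<circ> \<phi>) (at u) v) (frechet_derivative (?F t \<circ> \<phi>) (at u) w) = 0"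
        by (rule G(2))
      have mc: "mean_curvature_vector (?F t \<circ> \<phi>) u =
          act lam (chi_vf lam (cvec (orbit_point lam (c0 - t * a_H lam) (re_vec (fst (\<phi> u)))))) (snd (\<phi> u))"
        by (rule G(3))
      have "(\<gamma> (fst (\<phi> u)) has_vector_derivative chi_vf lam (\<gamma> (fst (\<phi> u)) t)) (at t within ?J)"
        using \<gamma> mem[OF u] t unfolding integral_curve_on_def by blast
      then have "((\<lambda>s. act lam (\<gamma> (fst (\<phi> u)) s) (snd (\<phi> u))) has_vector_derivative
          act lam (chi_vf lam (\<gamma> (fst (\<phi> u)) t)) (snd (\<phi> u))) (at t within ?J)"
        by (rule bounded_linear.has_vector_derivative[OF linear_act[unfolded linear_conv_bounded_linear]])
      then show "((\<lambda>s. ?F s (\<phi> u)) has_vector_derivative mean_curvature_vector (?F t \<circ> \<phi>) u) (at t within ?J)"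
        unfolding mc using flow[OF _ t, of "fst (\<phi> u)"] mem[OF u] by (simp add: case_prod_unfold)
    qed
    show "lagrangian_mcf ?J (N0 \<times> ?S) ?F"
      unfolding lagrangian_mcf_def lagrangian_immersion_def Let_def
    proof (intro conjI ballI allI impI sub)
      show "smooth_map_on (?J \<times> N0 \<times> ?S) (\<lambda>(t, q). ?F t q)"
        by (rule smooth_map_onI[OF open_orbit_dom[OF lam] _ Ck_on_orbit_ext[OF lam, of _ c0]]) (use ext in auto)
    next
      fix t assume t: "t \<in> ?J"
      have pair: "Ck_on k S (\<lambda>q. (t, q))" for k and S :: "((complex^'n) \<times> complex) set"
        by (rule Ck_on_subset[OF Ck_on_Pair[OF open_UNIV Ck_on_const Ck_on_ident]]) simp
      let ?W = "(\<lambda>q. (t, q)) -` orbit_dom lam c0"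
      have W: "open ?W"
        by (intro open_vimage open_orbit_dom[OF lam] Ck_on_imp_continuous_on[OF pair])
      show "smooth_map_on (N0 \<times> ?S) (?F t)"
        by (rule smooth_map_onI[OF W _ Ck_on_compose[OF W Ck_on_orbit_ext[OF lam, of _ c0] pair]]) (use ext[OF t] in auto)
    qed (use geom in auto)
  qed
qed

end
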